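(* Let $\tau=\tau_\lambda\colon\tilde{\mathcal{E}}_\lambda\to\mathcal{E}^\infty$ be the family, with parameter $\lambda$, of $(9|8)$-dimensional linear coverings, defined in the context, over the super-equation $\mathcal{E}$: $$u_t=u_{5x}+10uu_{xxx}+20u_xu_{xx}+30u^2u_x-5\xi_{xxx}\xi_x+15u\xi_{xx}\xi+15u_x\xi_x\xi,$$ $$\xi_t=\xi_{5x}+10u\xi_{xxx}+15u_x\xi_{xx}+5u_{xx}\xi_x+15u^2\xi_x+15uu_x\xi,$$ where $u$ is even and $\xi$ is odd. Then the deformation equation $$\frac{\mathrm d}{\mathrm d\lambda}U_\lambda=[X,U_\lambda]^{\mathrm{FN}}$$ for the structure element $U_\lambda$ of $\tau_\lambda$ does not admit any $\tau$-vertical solutions $X$.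
   Context: $\mathcal{E}^\infty$ is the infinite prolongation of $\mathcal{E}$ (coordinates $x,t$ and the $x$-derivatives of $u$ and $\xi$; $u_{kx},\xi_{kx}$ denote $k$-th $x$-derivatives); $\bar D_x,\bar D_t$ are the total derivatives restricted to it. The covering $\tilde{\mathcal{E}}_\lambda=W\times\mathcal{E}^\infty$ has even fibre variables $S,W_1,W_2,W_3,V_1,\dots,V_5$ and odd fibre variables $Q,Q_2,Q_3,O_1,\dots,O_5$; denote all 17 of them by $w^\ell$. The total derivatives on $\tilde{\mathcal{E}}_\lambda$ are $\tilde D_x=\bar D_x+w^\ell_x\,\vec\partial/\partial w^\ell$, $\tilde D_t=\bar D_t+w^\ell_t\,\vec\partial/\partial w^\ell$. A vector field $X$ is $\tau$-vertical if $X=\varphi^\ell\,\vec\partial/\partial w^\ell$ with $\varphi^\ell\in C^\infty(\tilde{\mathcal{E}}_\lambda)$ (it may depend on $\lambda$). The structure element is $$U_\lambda=\bar{\mathrm d}_{\mathcal C}(u_\sigma)\frac{\partial}{\partial u_\sigma}+\bar{\mathrm d}_{\mathcal C}(\xi_\sigma)\frac{\vec\partial}{\partial\xi_\sigma}+(\mathrm{d}w^\ell-w^\ell_x\,\mathrm{d}x-w^\ell_t\,\mathrm{d}t)\frac{\vec\partial}{\partial w^\ell},$$ with $\bar{\mathrm d}_{\mathcal C}=\bar{\mathrm d}-\bar{\mathrm d}_h$ the Cartan (vertical) differential, $\bar{\mathrm d}_h=\mathrm{d}x\,\bar D_x+\mathrm{d}t\,\bar D_t$. The Frölicher–Nijenhuis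 bracket of a vector-valued $r$-form $\Omega$ and a vector-valued $s$-form $\Theta$ is $[\Omega,\Theta]^{\mathrm{FN}}(g)=L_\Omega(\Theta(g))-(-1)^{rs+\mathsf{p}(\Omega)\mathsf{p}(\Theta)}L_\Theta(\Omega(g))$ for functions $g$, with $L_\Omega$ the Lie derivative and $\mathsf p$ the parity. The derivatives of the fibre variables are as follows. $x$-derivatives: $W_{3;x}=-O_3\xi-3O_1\xi u-9Q_2\xi u+3Qu\xi_x+2V_2u+S(6u^2+3\xi\xi_x)$, $W_{2;x}=2O_1\xi+2Su$, $\ W_{1;x}=S$, $\ S_x=V_1$, $\ V_{1;x}=V_2$, $\ V_{2;x}=V_3$, $\ V_{3;x}=V_4$, $\ V_{4;x}=V_5$, $V_{5;x}=6O_4\xi_x+O_3(3\xi_{xx}-18\xi u)+O_2(6u\xi_x-4\xi_{xxx}-29\xi u_x)+O_1(6u\xi_{xx}-4\xi_{4x}+11\xi_xu_x-36\xi u^2-15\xi u_{xx})-\tfrac32Q_3\xi_x+Q_2(21u\xi_{xx}+3\xi_{4x}+21\xi_xu_x+9\xi u^2)+\tfrac12Q(51u^2\xi_x+12u\xi_{xxx}-2\xi_{5x}+26\xi_{xx}u_x+22\xi_xu_{xx}-18\xi uu_x+2\xi u_{xxx})-12V_4u-30V_3u_x+V_2(-48u^2-40u_{xx}+15\xi\xi_x)+V_1(-140uu_x-30u_{xxx}+27\xi\xi_{xx})-2W_3u_x+W_2(-12uu_x-2u_{xxx}-3\xi\xi_{xx})+W_1(-60u^2u_x-20uu_{xxx}-2u_{5x}-40u_{xx}u_x+10\xi_{xxx}\xi_x+30\xi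 u\xi_{xx}+30\xi\xi_xu_x)+S(-64u^3-96uu_{xx}-12u_{4x}-72u_x^2+8\xi_{xx}\xi_x+90\xi u\xi_x+15\xi\xi_{xxx}-\lambda)$, $Q_{3;x}=2O_3u+7O_1u^2+Q_2(6u^2-6\xi\xi_x)-2V_3\xi-6W_2\xi u+14Su\xi_x$, $\quad Q_{2;x}=Qu+S\xi$, $Q_x=O_1$, $\ O_{1;x}=O_2$, $\ O_{2;x}=O_3$, $\ O_{3;x}=O_4$, $\ O_{4;x}=O_5$, $O_{5;x}=-12O_4u-24O_3u_x+O_2(-27u^2-19u_{xx}-2\xi\xi_x)+O_1(-63uu_x-7u_{xxx})-\tfrac32Q_3u+Q_2(-21uu_x-3u_{xxx})+\tfrac12Q(-35u^3-48uu_{xx}-2u_{4x}-40u_x^2+6\xi_{xx}\xi_x-4\xi\xi_{xxx}-2\lambda)-6V_3\xi_x+V_2(-21\xi_{xx}-21\xi u)+V_1(-50u\xi_x-23\xi_{xxx}-27\xi u_x)-2W_3\xi_x+W_2(6u\xi_x+\xi_{xxx}+3\xi u_x)+W_1(-30u^2\xi_x-20u\xi_{xxx}-2\xi_{5x}-30\xi_{xx}u_x-10\xi_xu_{xx}-30\xi uu_x)+S(-57u\xi_{xx}-11\xi_{4x}-52\xi_xu_x-36\xi u^2-15\xi u_{xx})$. $t$-derivatives: $S_t=-5O_3\xi_x+15O_2\xi u+O_1(5\xi_{xxx}+15\xi u_x)+Q(-15u\xi_{xx}-15\xi_xu_x)+V_5+10V_3u+20V_2u_x+V_1(30u^2+20u_{xx}-15\xi\xi_x)+S(60uu_x+10u_{xxx}-15\xi\xi_{xx})$,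 $Q_t=O_5+10O_3u+15O_2u_x+O_1(15u^2+5u_{xx})+15Quu_x+5V_2\xi_x+V_1(15\xi_{xx}+15\xi u)+S(30u\xi_x+10\xi_{xxx}+15\xi u_x)$, $V_{1;t}=\tilde D_x(S_t)$, $V_{k+1;t}=\tilde D_x(V_{k;t})$ for $k=1,\dots,4$; $\ O_{1;t}=\tilde D_x(Q_t)$, $O_{k+1;t}=\tilde D_x(O_{k;t})$ for $k=1,\dots,4$, $W_{1;t}=-5O_2\xi_x+O_1(5\xi_{xx}+15\xi u)-15Qu\xi_x+V_4+10V_2u+10V_1u_x+S(30u^2+10u_{xx}-15\xi\xi_x)$, $W_{2;t}=2O_5\xi-2O_4\xi_x+O_3(2\xi_{xx}+20\xi u)+O_2(-30u\xi_x-2\xi_{xxx}+30\xi u_x)+O_1(30u\xi_{xx}+2\xi_{4x}+60\xi u^2+10\xi u_{xx})+Q(-30u^2\xi_x+30\xi uu_x)+2V_4u-2V_3u_x+V_2(20u^2+2u_{xx}-10\xi\xi_x)+V_1(-2u_{xxx}-30\xi\xi_{xx})+S(60u^3+40uu_{xx}+2u_{4x}-30\xi_{xx}\xi_x-120\xi u\xi_x-20\xi\xi_{xxx})$, $Q_{2;t}=O_4u-O_3u_x+O_2(10u^2+u_{xx}+5\xi\xi_x)+O_1(-5uu_x-u_{xxx}-5\xi\xi_{xx})+Q(15u^3+10uu_{xx}+u_{4x}+5u_x^2-5\xi_{xx}\xi_x)+V_4\xi-V_3\xi_x+V_2(\xi_{xx}+10\xi u)+V_1(-5u\xi_x-\xi_{xxx}+10\xi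 u_x)+S(20u\xi_{xx}+\xi_{4x}-5\xi_xu_x+45\xi u^2+10\xi u_{xx})$, $W_{3;t}=O_5(-\xi_{xx}-\xi u)+O_4(6u\xi_x+\xi_{xxx}+4\xi u_x)+O_3(-20u\xi_{xx}-\xi_{4x}+2\xi_xu_x-30\xi u^2-5\xi u_{xx})+O_2(54u^2\xi_x+8u\xi_{xxx}-15\xi_{xx}u_x-2\xi_xu_{xx}+11\xi uu_x+4\xi u_{xxx})+O_1(-57u^2\xi_{xx}-4u\xi_{4x}+4u\xi_xu_x-\xi_{xxx}u_x-2\xi_{xx}u_{xx}-2\xi_xu_{xxx}-89\xi u^3-9\xi uu_{xx}-4\xi u_x^2-3\xi\xi_{xx}\xi_x+\xi\lambda)+\tfrac12Q_3(-9u\xi_x+3\xi u_x)+Q_2(-48u^2\xi_{xx}-3u\xi_{4x}+66u\xi_xu_x+9\xi_{xxx}u_x-9\xi_{xx}u_{xx}+6\xi_xu_{xxx}-108\xi u^3-69\xi uu_{xx}-6\xi u_{4x}-24\xi u_x^2+45\xi\xi_{xx}\xi_x)+\tfrac12Q(157u^3\xi_x+42u^2\xi_{xxx}+2u\xi_{5x}-32u\xi_{xx}u_x+38u\xi_xu_{xx}-6\xi_{4x}u_x+6\xi_{xxx}u_{xx}-6\xi_{xx}u_{xxx}+4\xi_xu_{4x}+44\xi_xu_x^2-2\xi_x\lambda+111\xi u^2u_x+28\xi uu_{xxx}+2\xi u_{5x}+38\xi u_{xx}u_x-14\xi\xi_{xxx}\xi_x)-2V_5u_x+V_4(2u^2+2u_{xx}+2\xi\xi_x)+V_3(-32uu_x-2u_{xxx}-5\xi\xi_{xx})+V_2(24u^3+32uu_{xx}+2u_{4x}-28u_x^2+\xi_{xx}\xi_x+15\xi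 u\xi_x+4\xi\xi_{xxx})+V_1(-100u^2u_x-12uu_{xxx}-16u_{xx}u_x-7\xi_{xxx}\xi_x-50\xi u\xi_{xx}-2\xi\xi_{4x}+18\xi\xi_xu_x)+W_3(-4uu_x-2\xi\xi_{xx})+W_2(-24u^2u_x-4uu_{xxx}+\xi_{xxx}\xi_x+\xi\xi_{4x}+12\xi\xi_xu_x)+W_1(-120u^3u_x-40u^2u_{xxx}-4uu_{5x}-80uu_{xx}u_x-2\xi_{5x}\xi_x-30\xi_{xx}\xi_xu_x+30\xi u^2\xi_{xx}-20\xi u\xi_{4x}-60\xi u\xi_xu_x-2\xi\xi_{6x}-50\xi\xi_{xxx}u_x-40\xi\xi_{xx}u_{xx}-10\xi\xi_xu_{xxx})+S(52u^4+108u^2u_{xx}+8uu_{4x}-144uu_x^2+97u\xi_{xx}\xi_x-2u\lambda-32u_{xxx}u_x+16u_{xx}^2+5\xi_{4x}\xi_x-16\xi_{xxx}\xi_{xx}+192\xi u^2\xi_x+33\xi u\xi_{xxx}-46\xi\xi_{xx}u_x+19\xi\xi_xu_{xx})$, $Q_{3;t}=O_5(3u^2+2u_{xx}+2\xi\xi_x)+O_4(-12uu_x-2u_{xxx}-2\xi\xi_{xx})+O_3(46u^3+38uu_{xx}+2u_{4x}+12u_x^2-14\xi_{xx}\xi_x+6\xi u\xi_x-2\xi\xi_{xxx})+O_2(-59u^2u_x-16uu_{xxx}+26u_{xx}u_x+2\xi_{xxx}\xi_x-10\xi u\xi_{xx}+4\xi\xi_{4x}+66\xi\xi_xu_x)+O_1(109u^4+121u^2u_{xx}+8uu_{4x}-12uu_x^2-12u\xi_{xx}\xi_x-2u\lambda-10u_{xxx}u_x+12u_{xx}^2+2\xi_{4x}\xi_x-10\xi_{xxx}\xi_{xx}-78\xi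 u^2\xi_x-18\xi u\xi_{xxx}-54\xi\xi_{xx}u_x+14\xi\xi_xu_{xx})-3Q_3\xi\xi_{xx}+Q_2(72u^4+78u^2u_{xx}+6uu_{4x}-138u\xi_{xx}\xi_x-6u_{xxx}u_x+6u_{xx}^2-6\xi_{4x}\xi_x+12\xi_{xxx}\xi_{xx}-198\xi u^2\xi_x-18\xi u\xi_{xxx}-6\xi\xi_{xx}u_x+12\xi\xi_xu_{xx})+Q(-67u^3u_x-30u^2u_{xxx}-2uu_{5x}+4uu_{xx}u_x+10u\xi_{xxx}\xi_x+2u_{4x}u_x+12u_x^3+2u_x\lambda-2\xi_{5x}\xi_x-64\xi_{xx}\xi_xu_x+153\xi u^2\xi_{xx}-10\xi u\xi_{4x}+66\xi u\xi_xu_x-2\xi\xi_{6x}-54\xi\xi_{xxx}u_x-36\xi\xi_{xx}u_{xx}-10\xi\xi_xu_{xxx})+V_5(-2\xi_{xx}+4\xi u)+V_4(8u\xi_x+2\xi_{xxx}+4\xi u_x)+V_3(-38u\xi_{xx}-2\xi_{4x}-12\xi_xu_x+24\xi u^2)+V_2(79u^2\xi_x+16u\xi_{xxx}-40\xi_{xx}u_x+14\xi_xu_{xx}+120\xi uu_x)+V_1(-123u^2\xi_{xx}-12u\xi_{4x}-52u\xi_xu_x+24\xi_{xxx}u_x-12\xi_{xx}u_{xx}-14\xi_xu_{xxx}+101\xi u^3+142\xi uu_{xx}+4\xi u_{4x}+64\xi u_x^2-82\xi\xi_{xx}\xi_x+2\xi\lambda)+W_3(-4u\xi_{xx}+4\xi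 u_{xx})+W_2(-48u^2\xi_{xx}-4u\xi_{4x}+12u\xi_xu_x+4\xi_{xxx}u_x-6\xi_{xx}u_{xx}+2\xi_xu_{xxx}-72\xi u^3-30\xi uu_{xx}-2\xi u_{4x}-12\xi u_x^2+18\xi\xi_{xx}\xi_x)+W_1(-60u^3\xi_{xx}-40u^2\xi_{4x}-240u^2\xi_xu_x-4u\xi_{6x}-60u\xi_{xxx}u_x-80u\xi_{xx}u_{xx}-60u\xi_xu_{xxx}+4\xi_{5x}u_x+60\xi_{xx}u_x^2-4\xi_xu_{5x}-60\xi_xu_{xx}u_x+60\xi u^2u_{xx}+40\xi uu_{4x}+240\xi uu_x^2+120\xi u\xi_{xx}\xi_x+4\xi u_{6x}+120\xi u_{xxx}u_x+80\xi u_{xx}^2-20\xi\xi_{4x}\xi_x-20\xi\xi_{xxx}\xi_{xx})+S(358u^3\xi_x+138u^2\xi_{xxx}+8u\xi_{5x}-192u\xi_{xx}u_x+244u\xi_xu_{xx}-12\xi_{4x}u_x+34\xi_{xxx}u_{xx}-34\xi_{xx}u_{xxx}+10\xi_xu_{4x}-12\xi_xu_x^2-2\xi_x\lambda+549\xi u^2u_x+102\xi uu_{xxx}+8\xi u_{5x}+224\xi u_{xx}u_x-48\xi\xi_{xxx}\xi_x)$. *)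

theory Defs
  imports "HOL-Analysis.Analysis"
begin

section \<open>Smooth functions of the even coordinates\<close>

text \<open>
  The even coordinates of the total space are \<open>x\<close>, \<open>t\<close> (\<open>Bx\<close>, \<open>Bt\<close>), the derivatives \<open>EU k\<close> of \<open>u\<close>, and the
  even fibre coordinates; the odd ones are the derivatives \<open>OXi k\<close> of \<open>\<xi>\<close> and the odd fibre
  coordinates.
\<close>

datatype even_coord = Bx | Bt | EU nat
  | ES | EW1 | EW2 | EW3 | EV1 | EV2 | EV3 | EV4 | EV5

datatype odd_coord = OXi nat
  | OQ | OQ2 | OQ3 | OO1 | OO2 | OO3 | OO4 | OO5

datatype coord = Ev even_coord | Od odd_coord

type_synonym point = "even_coord \<Rightarrow> real"

definition pde :: "even_coord \<Rightarrow> (point \<Rightarrow> real) \<Rightarrow> point \<Rightarrow> real" where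
  "pde a f p = deriv (\<lambda>s. f (p(a := s))) (p a)"

text \<open>
  As usual on an infinite prolongation, a smooth function depends on finitely many coordinates
  only; for such functions, continuity for the product topology is ordinary joint continuity.
\<close>

definition finitely_dependent :: "(point \<Rightarrow> real) \<Rightarrow> bool" where
  "finitely_dependent f \<longleftrightarrow>
     (\<exists>J. finite J \<and> (\<forall>p q. (\<forall>a\<in>J. p a = q a) \<longrightarrow> f p = f q))"

definition C1 :: "(point \<Rightarrow> real) \<Rightarrow> bool" where
  "C1 f \<longleftrightarrow> continuous_on UNIV f \<and>
     (\<forall>a p. (\<lambda>s. f (p(a := s))) field_differentiable at (p a)) \<and>
     (\<forall>a. continuous_on UNIV (pde a f))"

definition smooth :: "(point \<Rightarrow> real) \<Rightarrow> bool" where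
  "smooth f \<longleftrightarrow> finitely_dependent f \<and> (\<forall>as. C1 (foldr pde as f))"

lemma smooth_finitely_dependent: "smooth f \<Longrightarrow> finitely_dependent f"
  by (simp add: smooth_def)

lemma smooth_C1: "smooth f \<Longrightarrow> C1 f"
  unfolding smooth_def by (metis foldr_Nil id_apply)

lemma smooth_differentiable:
  "smooth f \<Longrightarrow> (\<lambda>s. f (p(a := s))) field_differentiable at (p a)"
  using smooth_C1 C1_def by blast

lemma smooth_has_pde:
  "smooth f \<Longrightarrow> ((\<lambda>s. f (p(a := s))) has_real_derivative pde a f p) (at (p a))"
  unfolding pde_def using smooth_differentiable field_differentiable_derivI by blast

lemma finitely_dependent_pde:
  assumes "finitely_dependent f" shows "finitely_dependent (pde a f)"
proof -
  obtain J where J: "finite J" "\<And>p q. (\<forall>a\<in>J. p a = q a) \<Longrightarrow> f p = f q"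
    using assms unfolding finitely_dependent_def by blast
  have "pde a f p = pde a f q" if "\<forall>b\<in>insert a J. p b = q b" for p q
  proof -
    have "(\<lambda>s. f (p(a := s))) = (\<lambda>s. f (q(a := s)))"
      by (rule ext, rule J(2)) (use that in auto)
    moreover have "p a = q a" using that by simp
    ultimately show ?thesis unfolding pde_def by simp
  qed
  then show ?thesis unfolding finitely_dependent_def
    by (intro exI[of _ "insert a J"] conjI allI impI) (simp_all add: J(1))
qed

lemma smooth_pde: assumes "smooth f" shows "smooth (pde a f)"
  unfolding smooth_def
proof (intro conjI allI)
  show "finitely_dependent (pde a f)"
    by (simp add: assms finitely_dependent_pde smooth_finitely_dependent)
  fix as
  have "foldr pde as (pde a f) = foldr pde (as @ [a]) f" by simp
  then show "C1 (foldr pde as (pde a f))" using assms unfolding smooth_def by metis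
qed

lemma smooth_coinduct:
  assumes "P f"
    and fd: "\<And>f. P f \<Longrightarrow> finitely_dependent f"
    and c: "\<And>f. P f \<Longrightarrow> continuous_on UNIV f"
    and d: "\<And>f a p. P f \<Longrightarrow> (\<lambda>s. f (p(a := s))) field_differentiable at (p a)"
    and st: "\<And>f a. P f \<Longrightarrow> P (pde a f)"
  shows "smooth f"
proof -
  have "P (foldr pde as f)" for as by (induction as) (use assms(1) st in auto)
  then show ?thesis unfolding smooth_def C1_def using fd c d st assms(1) by blast
qed

inductive smooth_alg :: "(point \<Rightarrow> real) \<Rightarrow> bool" where
  "smooth f \<Longrightarrow> smooth_alg f"
| "smooth_alg f \<Longrightarrow> smooth_alg g \<Longrightarrow> smooth_alg (\<lambda>p. f p + g p)"
| "smooth_alg f \<Longrightarrow> smooth_alg g \<Longrightarrow> smooth_alg (\<lambda>p. f p * g p)"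

lemma finitely_dependent_comb:
  assumes "finitely_dependent f" "finitely_dependent g"
  shows "finitely_dependent (\<lambda>p. h (f p) (g p))"
proof -
  obtain J K where J: "finite J" "\<And>p q. (\<forall>a\<in>J. p a = q a) \<Longrightarrow> f p = f q"
    and K: "finite K" "\<And>p q. (\<forall>a\<in>K. p a = q a) \<Longrightarrow> g p = g q"
    using assms unfolding finitely_dependent_def by blast
  have "h (f p) (g p) = h (f q) (g q)" if "\<forall>a\<in>J \<union> K. p a = q a" for p q
    using J(2)[of p q] K(2)[of p q] that by auto
  then show ?thesis unfolding finitely_dependent_def
    by (intro exI[of _ "J \<union> K"] conjI allI impI) (simp_all add: J(1) K(1))
qed

lemma pde_add:
  assumes "\<And>a p. (\<lambda>s. f (p(a := s))) field_differentiable at (p a)"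
    "\<And>a p. (\<lambda>s. g (p(a := s))) field_differentiable at (p a)"
  shows "pde a (\<lambda>p. f p + g p) = (\<lambda>p. pde a f p + pde a g p)"
  unfolding pde_def by (rule ext, rule deriv_add) (rule assms)+

lemma pde_mult:
  assumes "\<And>a p. (\<lambda>s. f (p(a := s))) field_differentiable at (p a)"
    "\<And>a p. (\<lambda>s. g (p(a := s))) field_differentiable at (p a)"
  shows "pde a (\<lambda>p. f p * g p) = (\<lambda>p. f p * pde a g p + pde a f p * g p)"
proof
  fix p
  have "deriv (\<lambda>s. f (p(a := s)) * g (p(a := s))) (p a) =
      f (p(a := p a)) * pde a g p + pde a f p * g (p(a := p a))"
    unfolding pde_def by (rule deriv_mult) (rule assms)+
  then show "pde a (\<lambda>p. f p * g p) p = f p * pde a g p + pde a f p * g p"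
    by (simp add: pde_def)
qed

lemma smooth_alg_props:
  assumes "smooth_alg f"
  shows "finitely_dependent f \<and> continuous_on UNIV f \<and>
    (\<forall>a p. (\<lambda>s. f (p(a := s))) field_differentiable at (p a)) \<and> (\<forall>a. smooth_alg (pde a f))"
  using assms
proof induction
  case (1 f)
  then show ?case
    using smooth_finitely_dependent[of f] smooth_C1[of f] smooth_alg.intros(1)[OF smooth_pde[of f]]
    unfolding C1_def by blast
next
  case (2 f g)
  then have d: "(\<lambda>s. f (p(a := s))) field_differentiable at (p a)"
    "(\<lambda>s. g (p(a := s))) field_differentiable at (p a)" for a p
    by blast+
  have "smooth_alg (pde a (\<lambda>p. f p + g p))" for a
    unfolding pde_add[of f g, OF d] using 2 by (intro smooth_alg.intros(2)) blast+
  moreover have "finitely_dependent (\<lambda>p. f p + g p)"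
    using finitely_dependent_comb[of f g "(+)"] 2 by simp
  moreover have "continuous_on UNIV (\<lambda>p. f p + g p)"
    using 2 by (simp add: continuous_on_add)
  moreover have "(\<lambda>s. f (p(a := s)) + g (p(a := s))) field_differentiable at (p a)" for a p
    by (rule field_differentiable_add[OF d])
  ultimately show ?case by blast
next
  case (3 f g)
  then have d: "(\<lambda>s. f (p(a := s))) field_differentiable at (p a)"
    "(\<lambda>s. g (p(a := s))) field_differentiable at (p a)" for a p
    by blast+
  have "smooth_alg (pde a (\<lambda>p. f p * g p))" for a
    unfolding pde_mult[of f g, OF d]
    using 3 by (intro smooth_alg.intros(2) smooth_alg.intros(3)) blast+
  moreover have "finitely_dependent (\<lambda>p. f p * g p)"
    using finitely_dependent_comb[of f g "(*)"] 3 by simp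
  moreover have "continuous_on UNIV (\<lambda>p. f p * g p)"
    using 3 by (simp add: continuous_on_mult)
  moreover have "(\<lambda>s. f (p(a := s)) * g (p(a := s))) field_differentiable at (p a)" for a p
    by (rule field_differentiable_mult[OF d])
  ultimately show ?case by blast
qed

lemma smooth_alg_smooth: "smooth_alg f \<Longrightarrow> smooth f"
  by (rule smooth_coinduct[where P = smooth_alg], assumption) (simp_all add: smooth_alg_props del: fun_upd_apply)

lemma smooth_add: "smooth f \<Longrightarrow> smooth g \<Longrightarrow> smooth (\<lambda>p. f p + g p)"
  by (rule smooth_alg_smooth[OF smooth_alg.intros(2)[OF smooth_alg.intros(1) smooth_alg.intros(1)]])

lemma smooth_mult: "smooth f \<Longrightarrow> smooth g \<Longrightarrow> smooth (\<lambda>p. f p * g p)"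
  by (rule smooth_alg_smooth[OF smooth_alg.intros(3)[OF smooth_alg.intros(1) smooth_alg.intros(1)]])

lemma pde_const: "pde a (\<lambda>p. c) = (\<lambda>p. 0)"
  by (rule ext) (simp add: pde_def)

lemma smooth_const: "smooth (\<lambda>p. c)"
proof (rule smooth_coinduct[where P = "\<lambda>f. \<exists>c. f = (\<lambda>p. c)"])
  show "\<exists>c'. (\<lambda>p. c) = (\<lambda>p. c')" by blast
  show "finitely_dependent f" if "\<exists>c. f = (\<lambda>p. c)" for f
    using that unfolding finitely_dependent_def by (metis finite.emptyI)
qed (auto simp: pde_const)

lemma smooth_cmult: "smooth f \<Longrightarrow> smooth (\<lambda>p. c * f p)"
  by (rule smooth_mult[OF smooth_const])

lemma smooth_minus: "smooth f \<Longrightarrow> smooth (\<lambda>p. - f p)"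
  using smooth_cmult[of f "-1"] by simp

lemma smooth_sum: "(\<And>i. i \<in> I \<Longrightarrow> smooth (f i)) \<Longrightarrow> smooth (\<lambda>p. \<Sum>i\<in>I. f i p)"
proof (induction I rule: infinite_finite_induct)
  case (insert x F)
  have "smooth (\<lambda>p. f x p + (\<Sum>i\<in>F. f i p))" using insert by (intro smooth_add) auto
  then show ?case using insert by simp
qed (simp_all add: smooth_const)

lemma pde_coord: "pde a (\<lambda>p. p b) = (\<lambda>p. if a = b then 1 else 0)"
  by (rule ext) (auto simp: pde_def)

lemma finitely_dependent_coord: "finitely_dependent (\<lambda>p. p b)"
  unfolding finitely_dependent_def by (rule exI[of _ "{b}"]) simp

lemma field_differentiable_coord:
  "(\<lambda>s. (p(a := s)) b) field_differentiable at (p a :: real)"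
  by (cases "a = b") simp_all

lemma smooth_coord: "smooth (\<lambda>p. p b)"
proof (rule smooth_coinduct[where P = "\<lambda>f. f = (\<lambda>p. p b) \<or> smooth f"])
  fix f a p
  assume f: "f = (\<lambda>p. p b) \<or> smooth f"
  show "finitely_dependent f"
    using f finitely_dependent_coord smooth_finitely_dependent by blast
  show "continuous_on UNIV f"
    using f smooth_C1[of f] by (auto simp: C1_def continuous_on_product_coordinates)
  show "(\<lambda>s. f (p(a := s))) field_differentiable at (p a)"
    using f smooth_differentiable[of f p a] field_differentiable_coord[of p a b] by blast
  show "pde a f = (\<lambda>p. p b) \<or> smooth (pde a f)"
  proof (cases "smooth f")
    case False
    then have "pde a f = (\<lambda>p. if a = b then 1 else 0)" using f by (simp add: pde_coord)
    then show ?thesis using smooth_const by simp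
  qed (simp add: smooth_pde)
qed simp


section \<open>The superalgebra of smooth functions\<close>

text \<open>
  A superfunction is a finite sum \<open>\<Sum>\<^sub>A f\<^sub>A \<theta>\<^sub>A\<close>, where \<open>\<theta>\<^sub>A\<close> is the product of the odd coordinates in the
  finite set \<open>A\<close>, taken in increasing order of \<open>odd_idx\<close>; the function \<open>A \<mapsto> f\<^sub>A\<close> represents it.
  The sign \<open>koszul B C\<close> is determined by \<open>\<theta>\<^sub>B \<theta>\<^sub>C = koszul B C \<theta>\<^sub>B\<^sub>\<union>\<^sub>C\<close> for disjoint \<open>B\<close>, \<open>C\<close>.
\<close>

fun odd_idx :: "odd_coord \<Rightarrow> nat" where
  "odd_idx OQ = 0" | "odd_idx OQ2 = 1" | "odd_idx OQ3 = 2"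
| "odd_idx OO1 = 3" | "odd_idx OO2 = 4" | "odd_idx OO3 = 5" | "odd_idx OO4 = 6"
| "odd_idx OO5 = 7"
| "odd_idx (OXi k) = 8 + k"

lemma odd_idx_inj: "odd_idx a = odd_idx b \<longleftrightarrow> a = b"
  by (cases a; cases b) auto

definition koszul :: "odd_coord set \<Rightarrow> odd_coord set \<Rightarrow> real" where
  "koszul B C = (-1) ^ card {(b, c) \<in> B \<times> C. odd_idx c < odd_idx b}"

lemma koszul_empty [simp]: "koszul {} C = 1" "koszul B {} = 1"
  by (simp_all add: koszul_def)

lemma koszul_Un_left:
  assumes "finite B" "finite B'" "finite C" "B \<inter> B' = {}"
  shows "koszul (B \<union> B') C = koszul B C * koszul B' C"
proof -
  have "{(b, c) \<in> (B \<union> B') \<times> C. odd_idx c < odd_idx b} =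
     {(b, c) \<in> B \<times> C. odd_idx c < odd_idx b} \<union> {(b, c) \<in> B' \<times> C. odd_idx c < odd_idx b}"
    by auto
  moreover have "card \<dots> = card {(b, c) \<in> B \<times> C. odd_idx c < odd_idx b}
      + card {(b, c) \<in> B' \<times> C. odd_idx c < odd_idx b}"
    by (rule card_Un_disjoint)
       (use assms in \<open>auto intro: finite_subset[of _ "B \<times> C"] finite_subset[of _ "B' \<times> C"]\<close>)
  ultimately show ?thesis unfolding koszul_def by (simp add: power_add)
qed

lemma koszul_Un_right:
  assumes "finite B" "finite C" "finite C'" "C \<inter> C' = {}"
  shows "koszul B (C \<union> C') = koszul B C * koszul B C'"
proof -
  have "{(b, c) \<in> B \<times> (C \<union> C'). odd_idx c < odd_idx b} =
     {(b, c) \<in> B \<times> C. odd_idx c < odd_idx b} \<union> {(b, c) \<in> B \<times> C'. odd_idx c < odd_idx b}"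
    by auto
  moreover have "card \<dots> = card {(b, c) \<in> B \<times> C. odd_idx c < odd_idx b}
      + card {(b, c) \<in> B \<times> C'. odd_idx c < odd_idx b}"
    by (rule card_Un_disjoint)
       (use assms in \<open>auto intro: finite_subset[of _ "B \<times> C"] finite_subset[of _ "B \<times> C'"]\<close>)
  ultimately show ?thesis unfolding koszul_def by (simp add: power_add)
qed

type_synonym raw = "odd_coord set \<Rightarrow> point \<Rightarrow> real"

definition superfunctions :: "raw set" where
  "superfunctions = {f. finite {A. f A \<noteq> (\<lambda>p. 0)} \<and>
     (\<forall>A. f A \<noteq> (\<lambda>p. 0) \<longrightarrow> finite A) \<and> (\<forall>A. smooth (f A))}"

lemma superfunctionsI:
  assumes "finite F" "\<And>A. A \<in> F \<Longrightarrow> finite A" "\<And>A. A \<notin> F \<Longrightarrow> f A = (\<lambda>p. 0)" "\<And>A. smooth (f A)"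
  shows "f \<in> superfunctions"
proof -
  have "{A. f A \<noteq> (\<lambda>p. 0)} \<subseteq> F" using assms(3) by blast
  then show ?thesis unfolding superfunctions_def using assms finite_subset by blast
qed

lemma superfunctionsD:
  assumes "f \<in> superfunctions"
  shows "finite {A. f A \<noteq> (\<lambda>p. 0)}" "infinite A \<Longrightarrow> f A = (\<lambda>p. 0)" "smooth (f A)"
    "f A \<noteq> (\<lambda>p. 0) \<Longrightarrow> finite A"
  using assms unfolding superfunctions_def by blast+

typedef sfun = superfunctions morphisms coeff Abs_sfun
  by (rule exI[of _ "\<lambda>_ _. 0"], rule superfunctionsI[of "{}"]) (simp_all add: smooth_const)

setup_lifting type_definition_sfun

lemma sfun_eqI: "(\<And>A p. coeff f A p = coeff g A p) \<Longrightarrow> f = g"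
  by (metis coeff_inject ext)

definition raw_mult :: "raw \<Rightarrow> raw \<Rightarrow> raw" where
  "raw_mult f g A p = (\<Sum>B\<in>Pow A. koszul B (A - B) * f B p * g (A - B) p)"

lemma raw_mult_super:
  assumes "f \<in> superfunctions" "g \<in> superfunctions"
  shows "raw_mult f g \<in> superfunctions"
proof (rule superfunctionsI)
  let ?F = "(\<lambda>(B, C). B \<union> C) ` ({A. f A \<noteq> (\<lambda>p. 0)} \<times> {A. g A \<noteq> (\<lambda>p. 0)})"
  show "finite ?F" using superfunctionsD(1)[OF assms(1)] superfunctionsD(1)[OF assms(2)] by blast
  show "finite A" if "A \<in> ?F" for A
    using that superfunctionsD(4)[OF assms(1)] superfunctionsD(4)[OF assms(2)] by auto
  show "raw_mult f g A = (\<lambda>p. 0)" if A: "A \<notin> ?F" for A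
  proof
    fix p
    have "koszul B (A - B) * f B p * g (A - B) p = 0" if "B \<in> Pow A" for B
    proof (rule ccontr)
      assume "\<not> ?thesis"
      then have "f B p \<noteq> 0" "g (A - B) p \<noteq> 0" by simp_all
      then have "f B \<noteq> (\<lambda>p. 0)" "g (A - B) \<noteq> (\<lambda>p. 0)" by metis+
      then have "(B, A - B) \<in> {A. f A \<noteq> (\<lambda>p. 0)} \<times> {A. g A \<noteq> (\<lambda>p. 0)}" by simp
      then have "(case (B, A - B) of (B, C) \<Rightarrow> B \<union> C) \<in> ?F" by (rule imageI)
      moreover have "B \<union> (A - B) = A" using that by blast
      ultimately show False using A by simp
    qed
    then show "raw_mult f g A p = 0" unfolding raw_mult_def by (rule sum.neutral[OF ballI])
  qed
  show "smooth (raw_mult f g A)" for A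
    unfolding raw_mult_def[abs_def]
    by (intro smooth_sum smooth_mult smooth_const superfunctionsD(3) assms)
qed

lemma superfunctions_comb:
  assumes "f \<in> superfunctions" "g \<in> superfunctions"
  shows "(\<lambda>A p. f A p + g A p) \<in> superfunctions"
proof (rule superfunctionsI)
  let ?F = "{A. f A \<noteq> (\<lambda>p. 0)} \<union> {A. g A \<noteq> (\<lambda>p. 0)}"
  show "finite ?F" using superfunctionsD(1)[OF assms(1)] superfunctionsD(1)[OF assms(2)] by blast
  show "finite A" if "A \<in> ?F" for A
    using that superfunctionsD(4)[OF assms(1)] superfunctionsD(4)[OF assms(2)] by auto
  show "(\<lambda>p. f A p + g A p) = (\<lambda>p. 0)" if "A \<notin> ?F" for A using that by simp
  show "smooth (\<lambda>p. f A p + g A p)" for A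
    by (intro smooth_add superfunctionsD(3) assms)
qed

lemma superfunctions_coeffwise:
  assumes "f \<in> superfunctions"
  shows "(\<lambda>A p. c A * f A p) \<in> superfunctions"
proof (rule superfunctionsI)
  let ?F = "{A. f A \<noteq> (\<lambda>p. 0)}"
  show "finite ?F" by (rule superfunctionsD(1)[OF assms])
  show "finite A" if "A \<in> ?F" for A using that superfunctionsD(4)[OF assms(1)] by auto
  show "(\<lambda>p. c A * f A p) = (\<lambda>p. 0)" if "A \<notin> ?F" for A using that by simp
  show "smooth (\<lambda>p. c A * f A p)" for A
    by (intro smooth_cmult superfunctionsD(3) assms)
qed

lemma superfunctions_single:
  assumes "finite B" "smooth h"
  shows "(\<lambda>A p. if A = B then h p else 0) \<in> superfunctions"
proof (rule superfunctionsI[of "{B}"])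
  show "smooth (\<lambda>p. if A = B then h p else 0)" for A
    by (cases "A = B") (simp_all add: assms smooth_const)
qed (use assms in auto)

instantiation sfun :: real_vector
begin

lift_definition zero_sfun :: sfun is "\<lambda>_ _. 0"
  by (rule superfunctionsI[of "{}"]) (simp_all add: smooth_const)

lift_definition plus_sfun :: "sfun \<Rightarrow> sfun \<Rightarrow> sfun" is "\<lambda>f g A p. f A p + g A p"
  by (rule superfunctions_comb)

lift_definition uminus_sfun :: "sfun \<Rightarrow> sfun" is "\<lambda>f A p. - f A p"
  using superfunctions_coeffwise[where c = "\<lambda>_. -1"] by simp

definition minus_sfun :: "sfun \<Rightarrow> sfun \<Rightarrow> sfun" where
  "minus_sfun f g = f + - g"

lift_definition scaleR_sfun :: "real \<Rightarrow> sfun \<Rightarrow> sfun" is "\<lambda>c f A p. c * f A p"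
  by (rule superfunctions_coeffwise)

instance
  by standard (unfold minus_sfun_def, (transfer, simp add: algebra_simps fun_eq_iff)+)

end

lemma raw_mult_assoc_sum:
  assumes "finite A"
  shows "(\<Sum>B\<in>Pow A. koszul B (A - B) *
            (\<Sum>C\<in>Pow B. koszul C (B - C) * f C * g (B - C)) * h (A - B)) =
         (\<Sum>C\<in>Pow A. koszul C (A - C) * f C *
            (\<Sum>D\<in>Pow (A - C). koszul D (A - C - D) * g D * h (A - C - D)))"
proof -
  have fin: "finite X" if "X \<subseteq> A" for X using assms that finite_subset by blast
  have "(\<Sum>B\<in>Pow A. koszul B (A - B) *
            (\<Sum>C\<in>Pow B. koszul C (B - C) * f C * g (B - C)) * h (A - B)) =
        (\<Sum>(B, C)\<in>Sigma (Pow A) Pow.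
            koszul B (A - B) * (koszul C (B - C) * f C * g (B - C)) * h (A - B))"
    by (subst sum.Sigma[symmetric])
       (use fin assms in \<open>auto simp: sum_distrib_left sum_distrib_right\<close>)
  also have "\<dots> = (\<Sum>(C, D)\<in>Sigma (Pow A) (\<lambda>C. Pow (A - C)).
            koszul C (A - C) * f C * (koszul D (A - C - D) * g D * h (A - C - D)))"
  proof (rule sum.reindex_bij_witness[where j = "\<lambda>(B, C). (C, B - C)"
        and i = "\<lambda>(C, D). (C \<union> D, C)"], goal_cases)
    case (5 z)
    then obtain B C where z: "z = (B, C)" "B \<subseteq> A" "C \<subseteq> B" by auto
    define D E where "D = B - C" and "E = A - B"
    have f: "finite C" "finite D" "finite E" using fin z D_def E_def by auto
    have B: "B = C \<union> D" "A - C = D \<union> E" "A - C - D = E" "C \<inter> D = {}" "D \<inter> E = {}"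
      using z D_def E_def by auto
    have "koszul B E * koszul C D = koszul C (A - C) * koszul D E"
      using B f by (simp add: koszul_Un_left koszul_Un_right)
    then show ?case using z B unfolding D_def[symmetric] E_def[symmetric]
      by simp
         (metis (no_types, opaque_lifting) D_def E_def mult.assoc mult.commute)
  qed auto
  also have "\<dots> = (\<Sum>C\<in>Pow A. koszul C (A - C) * f C *
            (\<Sum>D\<in>Pow (A - C). koszul D (A - C - D) * g D * h (A - C - D)))"
    by (subst sum.Sigma[symmetric])
       (use fin assms in \<open>auto simp: sum_distrib_left\<close>)
  finally show ?thesis .
qed

instantiation sfun :: real_algebra_1
begin

lift_definition one_sfun :: sfun is "\<lambda>A p. if A = {} then 1 else 0"
  by (rule superfunctions_single) (simp_all add: smooth_const)

lift_definition times_sfun :: "sfun \<Rightarrow> sfun \<Rightarrow> sfun" is raw_mult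
  by (rule raw_mult_super)

instance
proof
  fix a b c :: sfun and r :: real
  show "a * b * c = a * (b * c)"
  proof (transfer, intro ext)
    fix a b c :: raw and A p
    assume "a \<in> superfunctions" "b \<in> superfunctions" "c \<in> superfunctions"
    show "raw_mult (raw_mult a b) c A p = raw_mult a (raw_mult b c) A p"
    proof (cases "finite A")
      case True
      then show ?thesis unfolding raw_mult_def
        by (rule raw_mult_assoc_sum[of A "\<lambda>B. a B p" "\<lambda>B. b B p" "\<lambda>B. c B p"])
    qed (simp add: raw_mult_def)
  qed
  show "(a + b) * c = a * c + b * c"
    by transfer (simp add: raw_mult_def fun_eq_iff algebra_simps sum.distrib)
  show "a * (b + c) = a * b + a * c"
    by transfer (simp add: raw_mult_def fun_eq_iff algebra_simps sum.distrib)
  show "(0 :: sfun) \<noteq> 1"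
    by transfer (auto simp: fun_eq_iff)
  show "(r *\<^sub>R a) * b = r *\<^sub>R (a * b)" "a * (r *\<^sub>R b) = r *\<^sub>R (a * b)"
    by (transfer, simp add: raw_mult_def fun_eq_iff sum_distrib_left mult_ac)+
  show "1 * a = a"
  proof (transfer, intro ext)
    fix a :: raw and A p
    assume a: "a \<in> superfunctions"
    show "raw_mult (\<lambda>A p. if A = {} then 1 else 0) a A p = a A p"
    proof (cases "finite A")
      case True
      have "raw_mult (\<lambda>A p. if A = {} then 1 else 0) a A p =
          (\<Sum>B\<in>Pow A. if B = {} then a A p else 0)"
        unfolding raw_mult_def by (rule sum.cong) auto
      then show ?thesis using True by (simp add: sum.delta)
    qed (use superfunctionsD(2)[OF a] in \<open>simp add: raw_mult_def\<close>)
  qed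
  show "a * 1 = a"
  proof (transfer, intro ext)
    fix a :: raw and A p
    assume a: "a \<in> superfunctions"
    show "raw_mult a (\<lambda>A p. if A = {} then 1 else 0) A p = a A p"
    proof (cases "finite A")
      case True
      have "raw_mult a (\<lambda>A p. if A = {} then 1 else 0) A p =
          (\<Sum>B\<in>Pow A. if B = A then a A p else 0)"
        unfolding raw_mult_def by (rule sum.cong) auto
      then show ?thesis using True by (simp add: sum.delta)
    qed (use superfunctionsD(2)[OF a] in \<open>simp add: raw_mult_def\<close>)
  qed
qed

end

lift_definition coord_ev :: "even_coord \<Rightarrow> sfun" is "\<lambda>a A p. if A = {} then p a else 0"
  by (rule superfunctions_single) (simp_all add: smooth_coord)

lift_definition coord_od :: "odd_coord \<Rightarrow> sfun" is "\<lambda>c A p. if A = {c} then 1 else 0"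
  by (rule superfunctions_single) (simp_all add: smooth_const)

fun cf :: "coord \<Rightarrow> sfun" where
  "cf (Ev a) = coord_ev a"
| "cf (Od c) = coord_od c"

lift_definition pd_ev :: "even_coord \<Rightarrow> sfun \<Rightarrow> sfun" is "\<lambda>a f A. pde a (f A)"
proof -
  fix a f assume f: "f \<in> superfunctions"
  show "(\<lambda>A. pde a (f A)) \<in> superfunctions"
  proof (rule superfunctionsI)
    let ?F = "{A. f A \<noteq> (\<lambda>p. 0)}"
    show "finite ?F" by (rule superfunctionsD(1)[OF f])
    show "finite A" if "A \<in> ?F" for A using that superfunctionsD(4)[OF f] by auto
    show "pde a (f A) = (\<lambda>p. 0)" if "A \<notin> ?F" for A using that by (simp add: pde_const)
    show "smooth (pde a (f A))" for A by (intro smooth_pde superfunctionsD(3) f)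
  qed
qed

text \<open>The left derivative along the odd coordinate \<open>c\<close>: it maps \<open>c \<theta>\<^sub>A\<close> to \<open>\<theta>\<^sub>A\<close> if \<open>c \<notin> A\<close>.\<close>

lift_definition pd_od :: "odd_coord \<Rightarrow> sfun \<Rightarrow> sfun"
  is "\<lambda>c f A p. if c \<in> A then 0 else koszul {c} A * f (insert c A) p"
proof -
  fix c f assume f: "f \<in> superfunctions"
  show "(\<lambda>A p. if c \<in> A then 0 else koszul {c} A * f (insert c A) p) \<in> superfunctions"
  proof (rule superfunctionsI)
    let ?F = "(\<lambda>A. A - {c}) ` {A. f A \<noteq> (\<lambda>p. 0)}"
    show "finite ?F" using superfunctionsD(1)[OF f] by blast
    show "finite A" if "A \<in> ?F" for A using that superfunctionsD(4)[OF f] by auto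
    show "(\<lambda>p. if c \<in> A then 0 else koszul {c} A * f (insert c A) p) = (\<lambda>p. 0)"
      if "A \<notin> ?F" for A
    proof (cases "c \<in> A")
      case False
      then have "insert c A - {c} = A" by auto
      then have "f (insert c A) = (\<lambda>p. 0)"
        using that by (metis (mono_tags) image_eqI mem_Collect_eq)
      with False show ?thesis by simp
    qed simp
    show "smooth (\<lambda>p. if c \<in> A then 0 else koszul {c} A * f (insert c A) p)" for A
      by (cases "c \<in> A") (simp_all add: smooth_const smooth_cmult superfunctionsD(3)[OF f])
  qed
qed

fun pd :: "coord \<Rightarrow> sfun \<Rightarrow> sfun" where
  "pd (Ev a) f = pd_ev a f"
| "pd (Od c) f = pd_od c f"

text \<open>The parity involution: identity on even functions, minus identity on odd ones.\<close>

lift_definition parity_inv :: "sfun \<Rightarrow> sfun" is "\<lambda>f A p. (-1) ^ card A * f A p"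
  by (rule superfunctions_coeffwise)

lemma finite_pd_support: "finite {c. pd c f \<noteq> 0}"
proof -
  let ?S = "{A. coeff f A \<noteq> (\<lambda>p. 0)}"
  have S: "finite ?S" "\<And>A. A \<in> ?S \<Longrightarrow> finite A"
    using superfunctionsD[OF coeff[of f]] by blast+
  have "\<forall>A. \<exists>J. finite J \<and> (\<forall>p q. (\<forall>a\<in>J. p a = q a) \<longrightarrow> coeff f A p = coeff f A q)"
    using superfunctionsD(3)[OF coeff[of f]] smooth_finitely_dependent
    unfolding finitely_dependent_def by blast
  then obtain J where J: "\<And>A. finite (J A)"
    "\<And>A p q. (\<forall>a\<in>J A. p a = q a) \<Longrightarrow> coeff f A p = coeff f A q" by metis
  have "{c. pd c f \<noteq> 0} \<subseteq> Ev ` (\<Union>A\<in>?S. J A) \<union> Od ` \<Union>?S"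
  proof
    fix c assume "c \<in> {c. pd c f \<noteq> 0}"
    then have c: "pd c f \<noteq> 0" by simp
    show "c \<in> Ev ` (\<Union>A\<in>?S. J A) \<union> Od ` \<Union>?S"
    proof (cases c)
      case (Ev a)
      have "\<exists>A p. pde a (coeff f A) p \<noteq> 0"
        using c Ev sfun_eqI[of "pd c f" 0] by (auto simp: pd_ev.rep_eq zero_sfun.rep_eq)
      then obtain A p where A: "pde a (coeff f A) p \<noteq> 0" by blast
      have "A \<in> ?S" using A by (auto simp: pde_const)
      moreover have "a \<in> J A"
      proof (rule ccontr)
        assume "a \<notin> J A"
        then have "(\<lambda>s. coeff f A (p(a := s))) = (\<lambda>s. coeff f A p)"
          by (intro ext J(2)) auto
        then show False using A by (simp add: pde_def)
      qed
      ultimately show ?thesis using Ev by blast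
    next
      case (Od d)
      have "\<exists>A p. coeff (pd_od d f) A p \<noteq> 0"
        using c Od sfun_eqI[of "pd c f" 0] by (auto simp: zero_sfun.rep_eq)
      then obtain A p where "coeff f (insert d A) p \<noteq> 0"
        by (auto simp: pd_od.rep_eq split: if_splits)
      then have "insert d A \<in> ?S" by auto
      then show ?thesis using Od by blast
    qed
  qed
  then show ?thesis using S J(1) by (meson finite_UN_I finite_UnI finite_Union finite_imageI
        finite_subset)
qed


section \<open>Vector fields, forms, and the Froelicher--Nijenhuis bracket\<close>

text \<open>
  A vector field is given by its components in front of the \<open>\<partial>/\<partial>c\<close>, and a one-form
  \<open>\<Sum>\<^sub>c dc \<omega>\<^sub>c\<close> by its right coefficients \<open>\<omega>\<^sub>c\<close>; thus \<open>dd f = \<Sum>\<^sub>c dc \<partial>f/\<partial>c\<close> with left derivatives, and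
  \<open>\<omega> f\<close> has the coefficients \<open>\<omega>\<^sub>c f\<close>. A vector-valued one-form is given by the one-forms in front
  of the \<open>\<partial>/\<partial>c\<close>. The index sets of the sums over coordinates below are finite for differentials
  of superfunctions (see \<open>finite_pd_support\<close>), hence also for their contractions with a
  vector-valued form whose components have finitely many nonzero coefficients.
\<close>

type_synonym vfield = "coord \<Rightarrow> sfun"
type_synonym form = "coord \<Rightarrow> sfun"
type_synonym vform = "coord \<Rightarrow> form"

definition vapp :: "vfield \<Rightarrow> sfun \<Rightarrow> sfun" where
  "vapp X f = (\<Sum>c | pd c f \<noteq> 0. X c * pd c f)"

definition dd :: "sfun \<Rightarrow> form" where
  "dd f = (\<lambda>c. pd c f)"

definition contract :: "vform \<Rightarrow> form \<Rightarrow> form" where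
  "contract \<Omega> \<omega> = (\<lambda>e. \<Sum>c | \<omega> c \<noteq> 0. \<Omega> c e * \<omega> c)"

text \<open>
  The action of a vector-valued one-form on functions, \<open>\<Omega>(g) = \<Sum>\<^sub>c \<Omega>\<^sup>c \<partial>g/\<partial>c\<close>. It is also the Lie
  derivative of \<open>g\<close> along \<open>\<Omega>\<close>, that is, the contraction of \<open>dg\<close> with \<open>\<Omega>\<close>.
\<close>

definition vform_app :: "vform \<Rightarrow> sfun \<Rightarrow> form" where
  "vform_app \<Omega> g = contract \<Omega> (dd g)"

text \<open>
  The Lie derivative of one-forms along a vector field: it commutes with \<open>dd\<close> and satisfies
  \<open>L\<^sub>X(dc f) = d(X(c)) f + (-1)\<^bsup>p(X)p(c)\<^esup> dc X(f)\<close>. For a sum \<open>X\<close> of an even and an odd field this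
  is extended linearly: with \<open>P = parity_inv\<close>, the operator \<open>P X P\<close> is \<open>X\<close> for even \<open>X\<close> and \<open>-X\<close>
  for odd \<open>X\<close>.
\<close>

fun twist :: "coord \<Rightarrow> sfun \<Rightarrow> sfun" where
  "twist (Ev a) f = f"
| "twist (Od c) f = parity_inv f"

definition lie :: "vfield \<Rightarrow> form \<Rightarrow> form" where
  "lie X \<omega> = (\<lambda>e. (\<Sum>c | \<omega> c \<noteq> 0. dd (X c) e * \<omega> c) + twist e (vapp X (twist e (\<omega> e))))"

text \<open>
  The bracket \<open>[X, \<Omega>]\<close> of a vector field (a vector-valued 0-form) with an even vector-valued
  one-form, as an operator on functions:
  \<open>[X, \<Omega>](g) = L\<^sub>X(\<Omega>(g)) - (-1)\<^bsup>0\<cdot>1 + p(X)p(\<Omega>)\<^esup> L\<^sub>\<Omega>(X(g))\<close>, where the sign is \<open>1\<close> since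
  \<open>p(\<Omega>) = 0\<close>.
\<close>

definition fn_bracket :: "vfield \<Rightarrow> vform \<Rightarrow> sfun \<Rightarrow> form" where
  "fn_bracket X \<Omega> g = (\<lambda>e. lie X (vform_app \<Omega> g) e - vform_app \<Omega> (vapp X g) e)"


section \<open>The equation and its infinite prolongation\<close>

abbreviation fu :: "nat \<Rightarrow> sfun" where "fu k \<equiv> cf (Ev (EU k))"
abbreviation f\<xi> :: "nat \<Rightarrow> sfun" where "f\<xi> k \<equiv> cf (Od (OXi k))"

definition u_t :: sfun where
  "u_t = fu 5 + 10 * fu 0 * fu 3 + 20 * fu 1 * fu 2 + 30 * fu 0^2 * fu 1 - 5 * f\<xi> 3 * f\<xi> 1
     + 15 * fu 0 * f\<xi> 2 * f\<xi> 0 + 15 * fu 1 * f\<xi> 1 * f\<xi> 0"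

definition xi_t :: sfun where
  "xi_t = f\<xi> 5 + 10 * fu 0 * f\<xi> 3 + 15 * fu 1 * f\<xi> 2 + 5 * fu 2 * f\<xi> 1
     + 15 * fu 0^2 * f\<xi> 1 + 15 * fu 0 * fu 1 * f\<xi> 0"

text \<open>The total derivatives on functions of \<open>x\<close>, \<open>t\<close>, \<open>u\<^sub>k\<^sub>x\<close>, \<open>\<xi>\<^sub>k\<^sub>x\<close>, as vector fields.\<close>

fun Dx_bar_field :: vfield where
  "Dx_bar_field (Ev Bx) = 1"
| "Dx_bar_field (Ev (EU k)) = fu (Suc k)"
| "Dx_bar_field (Od (OXi k)) = f\<xi> (Suc k)"
| "Dx_bar_field c = 0"

definition Dx_bar :: "sfun \<Rightarrow> sfun" where
  "Dx_bar = vapp Dx_bar_field"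

fun Dt_bar_field :: vfield where
  "Dt_bar_field (Ev Bt) = 1"
| "Dt_bar_field (Ev (EU k)) = (Dx_bar ^^ k) u_t"
| "Dt_bar_field (Od (OXi k)) = (Dx_bar ^^ k) xi_t"
| "Dt_bar_field c = 0"

definition Dt_bar :: "sfun \<Rightarrow> sfun" where
  "Dt_bar = vapp Dt_bar_field"


section \<open>The covering\<close>

definition fibre_coords :: "coord set" where
  "fibre_coords = {Ev ES, Ev EW1, Ev EW2, Ev EW3, Ev EV1, Ev EV2, Ev EV3, Ev EV4, Ev EV5,
     Od OQ, Od OQ2, Od OQ3, Od OO1, Od OO2, Od OO3, Od OO4, Od OO5}"

abbreviation "fS \<equiv> cf (Ev ES)"
abbreviation "fW1 \<equiv> cf (Ev EW1)"
abbreviation "fW2 \<equiv> cf (Ev EW2)"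
abbreviation "fW3 \<equiv> cf (Ev EW3)"
abbreviation "fV1 \<equiv> cf (Ev EV1)"
abbreviation "fV2 \<equiv> cf (Ev EV2)"
abbreviation "fV3 \<equiv> cf (Ev EV3)"
abbreviation "fV4 \<equiv> cf (Ev EV4)"
abbreviation "fV5 \<equiv> cf (Ev EV5)"
abbreviation "fQ \<equiv> cf (Od OQ)"
abbreviation "fQ2 \<equiv> cf (Od OQ2)"
abbreviation "fQ3 \<equiv> cf (Od OQ3)"
abbreviation "fO1 \<equiv> cf (Od OO1)"
abbreviation "fO2 \<equiv> cf (Od OO2)"
abbreviation "fO3 \<equiv> cf (Od OO3)"
abbreviation "fO4 \<equiv> cf (Od OO4)"
abbreviation "fO5 \<equiv> cf (Od OO5)"

definition fW3_x :: "sfun" where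
  "fW3_x =
     - fO3 * f\<xi> 0 - 3 * fO1 * f\<xi> 0 * fu 0 - 9 * fQ2 * f\<xi> 0 * fu 0
     + 3 * fQ * fu 0 * f\<xi> 1 + 2 * fV2 * fu 0 + fS * (6 * fu 0^2 + 3 * f\<xi> 0 * f\<xi> 1)"

definition fV5_x :: "real \<Rightarrow> sfun" where
  "fV5_x lam =
     6 * fO4 * f\<xi> 1 + fO3 * (3 * f\<xi> 2 - 18 * f\<xi> 0 * fu 0) + fO2 * (6 * fu 0 * f\<xi> 1
     - 4 * f\<xi> 3 - 29 * f\<xi> 0 * fu 1) + fO1 * (6 * fu 0 * f\<xi> 2 - 4 * f\<xi> 4
     + 11 * f\<xi> 1 * fu 1 - 36 * f\<xi> 0 * fu 0^2 - 15 * f\<xi> 0 * fu 2)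
     - (3/2) *\<^sub>R (fQ3 * f\<xi> 1) + fQ2 * (21 * fu 0 * f\<xi> 2 + 3 * f\<xi> 4
     + 21 * f\<xi> 1 * fu 1 + 9 * f\<xi> 0 * fu 0^2)
     + (1/2) *\<^sub>R (fQ * (51 * fu 0^2 * f\<xi> 1 + 12 * fu 0 * f\<xi> 3 - 2 * f\<xi> 5
     + 26 * f\<xi> 2 * fu 1 + 22 * f\<xi> 1 * fu 2 - 18 * f\<xi> 0 * fu 0 * fu 1
     + 2 * f\<xi> 0 * fu 3)) - 12 * fV4 * fu 0 - 30 * fV3 * fu 1 + fV2 * (- 48 * fu 0^2
     - 40 * fu 2 + 15 * f\<xi> 0 * f\<xi> 1) + fV1 * (- 140 * fu 0 * fu 1 - 30 * fu 3
     + 27 * f\<xi> 0 * f\<xi> 2) - 2 * fW3 * fu 1 + fW2 * (- 12 * fu 0 * fu 1 - 2 * fu 3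
     - 3 * f\<xi> 0 * f\<xi> 2) + fW1 * (- 60 * fu 0^2 * fu 1 - 20 * fu 0 * fu 3 - 2 * fu 5
     - 40 * fu 2 * fu 1 + 10 * f\<xi> 3 * f\<xi> 1 + 30 * f\<xi> 0 * fu 0 * f\<xi> 2
     + 30 * f\<xi> 0 * f\<xi> 1 * fu 1) + fS * (- 64 * fu 0^3 - 96 * fu 0 * fu 2 - 12 * fu 4
     - 72 * fu 1^2 + 8 * f\<xi> 2 * f\<xi> 1 + 90 * f\<xi> 0 * fu 0 * f\<xi> 1
     + 15 * f\<xi> 0 * f\<xi> 3 - of_real lam)"

definition fQ3_x :: "sfun" where
  "fQ3_x =
     2 * fO3 * fu 0 + 7 * fO1 * fu 0^2 + fQ2 * (6 * fu 0^2 - 6 * f\<xi> 0 * f\<xi> 1)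
     - 2 * fV3 * f\<xi> 0 - 6 * fW2 * f\<xi> 0 * fu 0 + 14 * fS * fu 0 * f\<xi> 1"

definition fO5_x :: "real \<Rightarrow> sfun" where
  "fO5_x lam =
     - 12 * fO4 * fu 0 - 24 * fO3 * fu 1 + fO2 * (- 27 * fu 0^2 - 19 * fu 2
     - 2 * f\<xi> 0 * f\<xi> 1) + fO1 * (- 63 * fu 0 * fu 1 - 7 * fu 3)
     - (3/2) *\<^sub>R (fQ3 * fu 0) + fQ2 * (- 21 * fu 0 * fu 1 - 3 * fu 3)
     + (1/2) *\<^sub>R (fQ * (- 35 * fu 0^3 - 48 * fu 0 * fu 2 - 2 * fu 4 - 40 * fu 1^2
     + 6 * f\<xi> 2 * f\<xi> 1 - 4 * f\<xi> 0 * f\<xi> 3 - 2 * of_real lam)) - 6 * fV3 * f\<xi> 1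
     + fV2 * (- 21 * f\<xi> 2 - 21 * f\<xi> 0 * fu 0) + fV1 * (- 50 * fu 0 * f\<xi> 1
     - 23 * f\<xi> 3 - 27 * f\<xi> 0 * fu 1) - 2 * fW3 * f\<xi> 1 + fW2 * (6 * fu 0 * f\<xi> 1
     + f\<xi> 3 + 3 * f\<xi> 0 * fu 1) + fW1 * (- 30 * fu 0^2 * f\<xi> 1 - 20 * fu 0 * f\<xi> 3
     - 2 * f\<xi> 5 - 30 * f\<xi> 2 * fu 1 - 10 * f\<xi> 1 * fu 2 - 30 * f\<xi> 0 * fu 0 * fu 1)
     + fS * (- 57 * fu 0 * f\<xi> 2 - 11 * f\<xi> 4 - 52 * f\<xi> 1 * fu 1
     - 36 * f\<xi> 0 * fu 0^2 - 15 * f\<xi> 0 * fu 2)"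

fun fibre_x :: "real \<Rightarrow> coord \<Rightarrow> sfun" where
  "fibre_x lam (Ev EW3) = fW3_x"
| "fibre_x lam (Ev EW2) = 2 * fO1 * f\<xi> 0 + 2 * fS * fu 0"
| "fibre_x lam (Ev EW1) = fS"
| "fibre_x lam (Ev ES) = fV1"
| "fibre_x lam (Ev EV1) = fV2"
| "fibre_x lam (Ev EV2) = fV3"
| "fibre_x lam (Ev EV3) = fV4"
| "fibre_x lam (Ev EV4) = fV5"
| "fibre_x lam (Ev EV5) = fV5_x lam"
| "fibre_x lam (Od OQ3) = fQ3_x"
| "fibre_x lam (Od OQ2) = fQ * fu 0 + fS * f\<xi> 0"
| "fibre_x lam (Od OQ) = fO1"
| "fibre_x lam (Od OO1) = fO2"
| "fibre_x lam (Od OO2) = fO3"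
| "fibre_x lam (Od OO3) = fO4"
| "fibre_x lam (Od OO4) = fO5"
| "fibre_x lam (Od OO5) = fO5_x lam"
| "fibre_x lam c = 0"

definition Dx_field :: "real \<Rightarrow> vfield" where
  "Dx_field lam c = Dx_bar_field c + fibre_x lam c"

definition Dx :: "real \<Rightarrow> sfun \<Rightarrow> sfun" where
  "Dx lam = vapp (Dx_field lam)"

definition fS_t :: "sfun" where
  "fS_t =
     - 5 * fO3 * f\<xi> 1 + 15 * fO2 * f\<xi> 0 * fu 0 + fO1 * (5 * f\<xi> 3
     + 15 * f\<xi> 0 * fu 1) + fQ * (- 15 * fu 0 * f\<xi> 2 - 15 * f\<xi> 1 * fu 1) + fV5
     + 10 * fV3 * fu 0 + 20 * fV2 * fu 1 + fV1 * (30 * fu 0^2 + 20 * fu 2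
     - 15 * f\<xi> 0 * f\<xi> 1) + fS * (60 * fu 0 * fu 1 + 10 * fu 3 - 15 * f\<xi> 0 * f\<xi> 2)"

definition fQ_t :: "sfun" where
  "fQ_t =
     fO5 + 10 * fO3 * fu 0 + 15 * fO2 * fu 1 + fO1 * (15 * fu 0^2 + 5 * fu 2)
     + 15 * fQ * fu 0 * fu 1 + 5 * fV2 * f\<xi> 1 + fV1 * (15 * f\<xi> 2 + 15 * f\<xi> 0 * fu 0)
     + fS * (30 * fu 0 * f\<xi> 1 + 10 * f\<xi> 3 + 15 * f\<xi> 0 * fu 1)"

definition fW1_t :: "sfun" where
  "fW1_t =
     - 5 * fO2 * f\<xi> 1 + fO1 * (5 * f\<xi> 2 + 15 * f\<xi> 0 * fu 0)
     - 15 * fQ * fu 0 * f\<xi> 1 + fV4 + 10 * fV2 * fu 0 + 10 * fV1 * fu 1 + fS * (30 * fu 0^2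
     + 10 * fu 2 - 15 * f\<xi> 0 * f\<xi> 1)"

definition fW2_t :: "sfun" where
  "fW2_t =
     2 * fO5 * f\<xi> 0 - 2 * fO4 * f\<xi> 1 + fO3 * (2 * f\<xi> 2 + 20 * f\<xi> 0 * fu 0)
     + fO2 * (- 30 * fu 0 * f\<xi> 1 - 2 * f\<xi> 3 + 30 * f\<xi> 0 * fu 1)
     + fO1 * (30 * fu 0 * f\<xi> 2 + 2 * f\<xi> 4 + 60 * f\<xi> 0 * fu 0^2 + 10 * f\<xi> 0 * fu 2)
     + fQ * (- 30 * fu 0^2 * f\<xi> 1 + 30 * f\<xi> 0 * fu 0 * fu 1) + 2 * fV4 * fu 0
     - 2 * fV3 * fu 1 + fV2 * (20 * fu 0^2 + 2 * fu 2 - 10 * f\<xi> 0 * f\<xi> 1)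
     + fV1 * (- 2 * fu 3 - 30 * f\<xi> 0 * f\<xi> 2) + fS * (60 * fu 0^3 + 40 * fu 0 * fu 2
     + 2 * fu 4 - 30 * f\<xi> 2 * f\<xi> 1 - 120 * f\<xi> 0 * fu 0 * f\<xi> 1
     - 20 * f\<xi> 0 * f\<xi> 3)"

definition fQ2_t :: "sfun" where
  "fQ2_t =
     fO4 * fu 0 - fO3 * fu 1 + fO2 * (10 * fu 0^2 + fu 2 + 5 * f\<xi> 0 * f\<xi> 1)
     + fO1 * (- 5 * fu 0 * fu 1 - fu 3 - 5 * f\<xi> 0 * f\<xi> 2) + fQ * (15 * fu 0^3
     + 10 * fu 0 * fu 2 + fu 4 + 5 * fu 1^2 - 5 * f\<xi> 2 * f\<xi> 1) + fV4 * f\<xi> 0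
     - fV3 * f\<xi> 1 + fV2 * (f\<xi> 2 + 10 * f\<xi> 0 * fu 0) + fV1 * (- 5 * fu 0 * f\<xi> 1
     - f\<xi> 3 + 10 * f\<xi> 0 * fu 1) + fS * (20 * fu 0 * f\<xi> 2 + f\<xi> 4
     - 5 * f\<xi> 1 * fu 1 + 45 * f\<xi> 0 * fu 0^2 + 10 * f\<xi> 0 * fu 2)"

definition fW3_t :: "real \<Rightarrow> sfun" where
  "fW3_t lam =
     fO5 * (- f\<xi> 2 - f\<xi> 0 * fu 0) + fO4 * (6 * fu 0 * f\<xi> 1 + f\<xi> 3
     + 4 * f\<xi> 0 * fu 1) + fO3 * (- 20 * fu 0 * f\<xi> 2 - f\<xi> 4 + 2 * f\<xi> 1 * fu 1
     - 30 * f\<xi> 0 * fu 0^2 - 5 * f\<xi> 0 * fu 2) + fO2 * (54 * fu 0^2 * f\<xi> 1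
     + 8 * fu 0 * f\<xi> 3 - 15 * f\<xi> 2 * fu 1 - 2 * f\<xi> 1 * fu 2
     + 11 * f\<xi> 0 * fu 0 * fu 1 + 4 * f\<xi> 0 * fu 3) + fO1 * (- 57 * fu 0^2 * f\<xi> 2
     - 4 * fu 0 * f\<xi> 4 + 4 * fu 0 * f\<xi> 1 * fu 1 - f\<xi> 3 * fu 1 - 2 * f\<xi> 2 * fu 2
     - 2 * f\<xi> 1 * fu 3 - 89 * f\<xi> 0 * fu 0^3 - 9 * f\<xi> 0 * fu 0 * fu 2
     - 4 * f\<xi> 0 * fu 1^2 - 3 * f\<xi> 0 * f\<xi> 2 * f\<xi> 1 + f\<xi> 0 * of_real lam)
     + (1/2) *\<^sub>R (fQ3 * (- 9 * fu 0 * f\<xi> 1 + 3 * f\<xi> 0 * fu 1))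
     + fQ2 * (- 48 * fu 0^2 * f\<xi> 2 - 3 * fu 0 * f\<xi> 4 + 66 * fu 0 * f\<xi> 1 * fu 1
     + 9 * f\<xi> 3 * fu 1 - 9 * f\<xi> 2 * fu 2 + 6 * f\<xi> 1 * fu 3 - 108 * f\<xi> 0 * fu 0^3
     - 69 * f\<xi> 0 * fu 0 * fu 2 - 6 * f\<xi> 0 * fu 4 - 24 * f\<xi> 0 * fu 1^2
     + 45 * f\<xi> 0 * f\<xi> 2 * f\<xi> 1) + (1/2) *\<^sub>R (fQ * (157 * fu 0^3 * f\<xi> 1
     + 42 * fu 0^2 * f\<xi> 3 + 2 * fu 0 * f\<xi> 5 - 32 * fu 0 * f\<xi> 2 * fu 1
     + 38 * fu 0 * f\<xi> 1 * fu 2 - 6 * f\<xi> 4 * fu 1 + 6 * f\<xi> 3 * fu 2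
     - 6 * f\<xi> 2 * fu 3 + 4 * f\<xi> 1 * fu 4 + 44 * f\<xi> 1 * fu 1^2
     - 2 * f\<xi> 1 * of_real lam + 111 * f\<xi> 0 * fu 0^2 * fu 1 + 28 * f\<xi> 0 * fu 0 * fu 3
     + 2 * f\<xi> 0 * fu 5 + 38 * f\<xi> 0 * fu 2 * fu 1 - 14 * f\<xi> 0 * f\<xi> 3 * f\<xi> 1))
     - 2 * fV5 * fu 1 + fV4 * (2 * fu 0^2 + 2 * fu 2 + 2 * f\<xi> 0 * f\<xi> 1)
     + fV3 * (- 32 * fu 0 * fu 1 - 2 * fu 3 - 5 * f\<xi> 0 * f\<xi> 2) + fV2 * (24 * fu 0^3
     + 32 * fu 0 * fu 2 + 2 * fu 4 - 28 * fu 1^2 + f\<xi> 2 * f\<xi> 1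
     + 15 * f\<xi> 0 * fu 0 * f\<xi> 1 + 4 * f\<xi> 0 * f\<xi> 3) + fV1 * (- 100 * fu 0^2 * fu 1
     - 12 * fu 0 * fu 3 - 16 * fu 2 * fu 1 - 7 * f\<xi> 3 * f\<xi> 1
     - 50 * f\<xi> 0 * fu 0 * f\<xi> 2 - 2 * f\<xi> 0 * f\<xi> 4
     + 18 * f\<xi> 0 * f\<xi> 1 * fu 1) + fW3 * (- 4 * fu 0 * fu 1 - 2 * f\<xi> 0 * f\<xi> 2)
     + fW2 * (- 24 * fu 0^2 * fu 1 - 4 * fu 0 * fu 3 + f\<xi> 3 * f\<xi> 1 + f\<xi> 0 * f\<xi> 4
     + 12 * f\<xi> 0 * f\<xi> 1 * fu 1) + fW1 * (- 120 * fu 0^3 * fu 1 - 40 * fu 0^2 * fu 3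
     - 4 * fu 0 * fu 5 - 80 * fu 0 * fu 2 * fu 1 - 2 * f\<xi> 5 * f\<xi> 1
     - 30 * f\<xi> 2 * f\<xi> 1 * fu 1 + 30 * f\<xi> 0 * fu 0^2 * f\<xi> 2
     - 20 * f\<xi> 0 * fu 0 * f\<xi> 4 - 60 * f\<xi> 0 * fu 0 * f\<xi> 1 * fu 1
     - 2 * f\<xi> 0 * f\<xi> 6 - 50 * f\<xi> 0 * f\<xi> 3 * fu 1 - 40 * f\<xi> 0 * f\<xi> 2 * fu 2
     - 10 * f\<xi> 0 * f\<xi> 1 * fu 3) + fS * (52 * fu 0^4 + 108 * fu 0^2 * fu 2
     + 8 * fu 0 * fu 4 - 144 * fu 0 * fu 1^2 + 97 * fu 0 * f\<xi> 2 * f\<xi> 1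
     - 2 * fu 0 * of_real lam - 32 * fu 3 * fu 1 + 16 * fu 2^2 + 5 * f\<xi> 4 * f\<xi> 1
     - 16 * f\<xi> 3 * f\<xi> 2 + 192 * f\<xi> 0 * fu 0^2 * f\<xi> 1
     + 33 * f\<xi> 0 * fu 0 * f\<xi> 3 - 46 * f\<xi> 0 * f\<xi> 2 * fu 1
     + 19 * f\<xi> 0 * f\<xi> 1 * fu 2)"

definition fQ3_t :: "real \<Rightarrow> sfun" where
  "fQ3_t lam =
     fO5 * (3 * fu 0^2 + 2 * fu 2 + 2 * f\<xi> 0 * f\<xi> 1) + fO4 * (- 12 * fu 0 * fu 1
     - 2 * fu 3 - 2 * f\<xi> 0 * f\<xi> 2) + fO3 * (46 * fu 0^3 + 38 * fu 0 * fu 2 + 2 * fu 4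
     + 12 * fu 1^2 - 14 * f\<xi> 2 * f\<xi> 1 + 6 * f\<xi> 0 * fu 0 * f\<xi> 1
     - 2 * f\<xi> 0 * f\<xi> 3) + fO2 * (- 59 * fu 0^2 * fu 1 - 16 * fu 0 * fu 3
     + 26 * fu 2 * fu 1 + 2 * f\<xi> 3 * f\<xi> 1 - 10 * f\<xi> 0 * fu 0 * f\<xi> 2
     + 4 * f\<xi> 0 * f\<xi> 4 + 66 * f\<xi> 0 * f\<xi> 1 * fu 1) + fO1 * (109 * fu 0^4
     + 121 * fu 0^2 * fu 2 + 8 * fu 0 * fu 4 - 12 * fu 0 * fu 1^2
     - 12 * fu 0 * f\<xi> 2 * f\<xi> 1 - 2 * fu 0 * of_real lam - 10 * fu 3 * fu 1 + 12 * fu 2^2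
     + 2 * f\<xi> 4 * f\<xi> 1 - 10 * f\<xi> 3 * f\<xi> 2 - 78 * f\<xi> 0 * fu 0^2 * f\<xi> 1
     - 18 * f\<xi> 0 * fu 0 * f\<xi> 3 - 54 * f\<xi> 0 * f\<xi> 2 * fu 1
     + 14 * f\<xi> 0 * f\<xi> 1 * fu 2) - 3 * fQ3 * f\<xi> 0 * f\<xi> 2 + fQ2 * (72 * fu 0^4
     + 78 * fu 0^2 * fu 2 + 6 * fu 0 * fu 4 - 138 * fu 0 * f\<xi> 2 * f\<xi> 1 - 6 * fu 3 * fu 1
     + 6 * fu 2^2 - 6 * f\<xi> 4 * f\<xi> 1 + 12 * f\<xi> 3 * f\<xi> 2
     - 198 * f\<xi> 0 * fu 0^2 * f\<xi> 1 - 18 * f\<xi> 0 * fu 0 * f\<xi> 3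
     - 6 * f\<xi> 0 * f\<xi> 2 * fu 1 + 12 * f\<xi> 0 * f\<xi> 1 * fu 2)
     + fQ * (- 67 * fu 0^3 * fu 1 - 30 * fu 0^2 * fu 3 - 2 * fu 0 * fu 5 + 4 * fu 0 * fu 2 * fu 1
     + 10 * fu 0 * f\<xi> 3 * f\<xi> 1 + 2 * fu 4 * fu 1 + 12 * fu 1^3 + 2 * fu 1 * of_real lam
     - 2 * f\<xi> 5 * f\<xi> 1 - 64 * f\<xi> 2 * f\<xi> 1 * fu 1
     + 153 * f\<xi> 0 * fu 0^2 * f\<xi> 2 - 10 * f\<xi> 0 * fu 0 * f\<xi> 4
     + 66 * f\<xi> 0 * fu 0 * f\<xi> 1 * fu 1 - 2 * f\<xi> 0 * f\<xi> 6
     - 54 * f\<xi> 0 * f\<xi> 3 * fu 1 - 36 * f\<xi> 0 * f\<xi> 2 * fu 2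
     - 10 * f\<xi> 0 * f\<xi> 1 * fu 3) + fV5 * (- 2 * f\<xi> 2 + 4 * f\<xi> 0 * fu 0)
     + fV4 * (8 * fu 0 * f\<xi> 1 + 2 * f\<xi> 3 + 4 * f\<xi> 0 * fu 1)
     + fV3 * (- 38 * fu 0 * f\<xi> 2 - 2 * f\<xi> 4 - 12 * f\<xi> 1 * fu 1
     + 24 * f\<xi> 0 * fu 0^2) + fV2 * (79 * fu 0^2 * f\<xi> 1 + 16 * fu 0 * f\<xi> 3
     - 40 * f\<xi> 2 * fu 1 + 14 * f\<xi> 1 * fu 2 + 120 * f\<xi> 0 * fu 0 * fu 1)
     + fV1 * (- 123 * fu 0^2 * f\<xi> 2 - 12 * fu 0 * f\<xi> 4 - 52 * fu 0 * f\<xi> 1 * fu 1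
     + 24 * f\<xi> 3 * fu 1 - 12 * f\<xi> 2 * fu 2 - 14 * f\<xi> 1 * fu 3
     + 101 * f\<xi> 0 * fu 0^3 + 142 * f\<xi> 0 * fu 0 * fu 2 + 4 * f\<xi> 0 * fu 4
     + 64 * f\<xi> 0 * fu 1^2 - 82 * f\<xi> 0 * f\<xi> 2 * f\<xi> 1 + 2 * f\<xi> 0 * of_real lam)
     + fW3 * (- 4 * fu 0 * f\<xi> 2 + 4 * f\<xi> 0 * fu 2) + fW2 * (- 48 * fu 0^2 * f\<xi> 2
     - 4 * fu 0 * f\<xi> 4 + 12 * fu 0 * f\<xi> 1 * fu 1 + 4 * f\<xi> 3 * fu 1
     - 6 * f\<xi> 2 * fu 2 + 2 * f\<xi> 1 * fu 3 - 72 * f\<xi> 0 * fu 0^3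
     - 30 * f\<xi> 0 * fu 0 * fu 2 - 2 * f\<xi> 0 * fu 4 - 12 * f\<xi> 0 * fu 1^2
     + 18 * f\<xi> 0 * f\<xi> 2 * f\<xi> 1) + fW1 * (- 60 * fu 0^3 * f\<xi> 2
     - 40 * fu 0^2 * f\<xi> 4 - 240 * fu 0^2 * f\<xi> 1 * fu 1 - 4 * fu 0 * f\<xi> 6
     - 60 * fu 0 * f\<xi> 3 * fu 1 - 80 * fu 0 * f\<xi> 2 * fu 2 - 60 * fu 0 * f\<xi> 1 * fu 3
     + 4 * f\<xi> 5 * fu 1 + 60 * f\<xi> 2 * fu 1^2 - 4 * f\<xi> 1 * fu 5
     - 60 * f\<xi> 1 * fu 2 * fu 1 + 60 * f\<xi> 0 * fu 0^2 * fu 2 + 40 * f\<xi> 0 * fu 0 * fu 4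
     + 240 * f\<xi> 0 * fu 0 * fu 1^2 + 120 * f\<xi> 0 * fu 0 * f\<xi> 2 * f\<xi> 1
     + 4 * f\<xi> 0 * fu 6 + 120 * f\<xi> 0 * fu 3 * fu 1 + 80 * f\<xi> 0 * fu 2^2
     - 20 * f\<xi> 0 * f\<xi> 4 * f\<xi> 1 - 20 * f\<xi> 0 * f\<xi> 3 * f\<xi> 2)
     + fS * (358 * fu 0^3 * f\<xi> 1 + 138 * fu 0^2 * f\<xi> 3 + 8 * fu 0 * f\<xi> 5
     - 192 * fu 0 * f\<xi> 2 * fu 1 + 244 * fu 0 * f\<xi> 1 * fu 2 - 12 * f\<xi> 4 * fu 1
     + 34 * f\<xi> 3 * fu 2 - 34 * f\<xi> 2 * fu 3 + 10 * f\<xi> 1 * fu 4 - 12 * f\<xi> 1 * fu 1^2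
     - 2 * f\<xi> 1 * of_real lam + 549 * f\<xi> 0 * fu 0^2 * fu 1 + 102 * f\<xi> 0 * fu 0 * fu 3
     + 8 * f\<xi> 0 * fu 5 + 224 * f\<xi> 0 * fu 2 * fu 1 - 48 * f\<xi> 0 * f\<xi> 3 * f\<xi> 1)"

fun fibre_t :: "real \<Rightarrow> coord \<Rightarrow> sfun" where
  "fibre_t lam (Ev ES) = fS_t"
| "fibre_t lam (Od OQ) = fQ_t"
| "fibre_t lam (Ev EW1) = fW1_t"
| "fibre_t lam (Ev EW2) = fW2_t"
| "fibre_t lam (Od OQ2) = fQ2_t"
| "fibre_t lam (Ev EW3) = fW3_t lam"
| "fibre_t lam (Od OQ3) = fQ3_t lam"
| "fibre_t lam (Ev EV1) = Dx lam fS_t"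
| "fibre_t lam (Ev EV2) = (Dx lam ^^ 2) fS_t"
| "fibre_t lam (Ev EV3) = (Dx lam ^^ 3) fS_t"
| "fibre_t lam (Ev EV4) = (Dx lam ^^ 4) fS_t"
| "fibre_t lam (Ev EV5) = (Dx lam ^^ 5) fS_t"
| "fibre_t lam (Od OO1) = Dx lam fQ_t"
| "fibre_t lam (Od OO2) = (Dx lam ^^ 2) fQ_t"
| "fibre_t lam (Od OO3) = (Dx lam ^^ 3) fQ_t"
| "fibre_t lam (Od OO4) = (Dx lam ^^ 4) fQ_t"
| "fibre_t lam (Od OO5) = (Dx lam ^^ 5) fQ_t"
| "fibre_t lam c = 0"

definition Dt_field :: "real \<Rightarrow> vfield" where
  "Dt_field lam c = Dt_bar_field c + fibre_t lam c"

definition Dt :: "real \<Rightarrow> sfun \<Rightarrow> sfun" where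
  "Dt lam = vapp (Dt_field lam)"

definition tau_vertical :: "vfield \<Rightarrow> bool" where
  "tau_vertical X \<longleftrightarrow> (\<forall>c. c \<notin> fibre_coords \<longrightarrow> X c = 0)"

abbreviation dx :: form where "dx \<equiv> dd (cf (Ev Bx))"
abbreviation dt :: form where "dt \<equiv> dd (cf (Ev Bt))"

text \<open>
  The Cartan differential \<open>d\<^sub>C = d - dx D\<^sub>x - dt D\<^sub>t\<close> of the base equation.
\<close>

definition d_cartan :: "sfun \<Rightarrow> form" where
  "d_cartan f = (\<lambda>e. dd f e - dx e * Dx_bar f - dt e * Dt_bar f)"

definition structure_element :: "real \<Rightarrow> vform" where
  "structure_element lam c =
     (if c \<in> fibre_coords
      then (\<lambda>e. dd (cf c) e - dx e * fibre_x lam c - dt e * fibre_t lam c)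
      else if c \<in> {Ev Bx, Ev Bt} then (\<lambda>e. 0)
      else d_cartan (cf c))"

text \<open>
  The equation \<open>dU\<^sub>\<lambda>/d\<lambda> = [X, U\<^sub>\<lambda>]\<close> at the parameter value \<open>lam\<close>. Both sides are operators from
  functions to one-forms, and the derivative in \<open>\<lambda>\<close> is that of every coefficient at every point.
  Only the value of \<open>X\<close> at \<open>lam\<close> enters, since \<open>X\<close> is not differentiated in \<open>\<lambda>\<close>; a family of vector
  fields solves the equation iff each of its members solves it at its own parameter value.
\<close>

definition deformation_equation :: "real \<Rightarrow> vfield \<Rightarrow> bool" where
  "deformation_equation lam X \<longleftrightarrow>
     (\<forall>g e A p. ((\<lambda>l. coeff (vform_app (structure_element l) g e) A p) has_real_derivative
        coeff (fn_bracket X (structure_element lam) g e) A p) (at lam))"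

end

theory Submission
  imports Defs
begin

text \<open>
  At \<open>\<xi> = 0\<close> the \<open>dx\<close>-part of the deformation equation for the components \<open>F\<^sub>w\<close> of \<open>X\<close> along the even fibre
  coordinates reads \<open>D\<^sub>x F\<^sub>w = \<Sum>\<^sub>c F\<^sub>c \<partial>w\<^sub>x/\<partial>c - \<partial>w\<^sub>x/\<partial>\<lambda>\<close>. It already has no solution to first order in the
  fibre coordinates and in \<open>u\<close>. Let \<open>g\<close> and \<open>s\<close> be the linear parts of \<open>F\<close> for \<open>W\<^sub>2\<close> and \<open>S\<close> at \<open>u = 0\<close>. The
  first-order part in \<open>u\<close> of \<open>D\<^sub>x F = 2 u F\<^sub>S\<close>, for \<open>F\<close> the component along \<open>W\<^sub>2\<close>, involves only finitely
  many \<open>u\<^sub>k\<^sub>x\<close>, and its Euler operator expresses \<open>s\<close> through \<open>g\<close>: up to constants,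
  \<open>s i = - g (i + 1)\<close>. The chain \<open>S, V\<^sub>1, \<dots>, V\<^sub>5\<close> says that the sixth covariant \<open>x\<close>-derivative of \<open>s\<close> is
  \<open>- \<lambda> s + S\<close>. Comparing coefficients gives \<open>\<lambda> g 3 = 0\<close> and \<open>\<lambda> g 2 = - 1\<close>, which contradicts
  \<open>(g 3)' = - g 2\<close>.
\<close>

section \<open>Mixed partial derivatives\<close>

lemma pde_line:
  assumes "smooth f"
  shows "((\<lambda>s. f (p(a := s))) has_real_derivative pde a f (p(a := s))) (at s)"
  using smooth_has_pde[OF assms, of "p(a := s)" a] by simp

text \<open>The mean value theorem is used twice: in \<open>a\<close> for the increment of
  \<open>f\<close> in \<open>b\<close>, then in \<open>b\<close> for \<open>pde a f\<close>.\<close>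

lemma second_difference_mvt:
  assumes f: "smooth f" and "a \<noteq> b" and h: "0 < h"
  obtains s r where "p a < s" "s < p a + h" "p b < r" "r < p b + h"
    "f (p(a := p a + h, b := p b + h)) - f (p(a := p a + h)) - f (p(b := p b + h)) + f p =
       h * h * pde b (pde a f) (p(a := s, b := r))"
proof -
  let ?\<phi> = "\<lambda>s. f (p(b := p b + h, a := s)) - f (p(a := s))"
  have "(?\<phi> has_real_derivative pde a f (p(b := p b + h, a := s)) - pde a f (p(a := s))) (at s)" for s
    by (intro DERIV_diff pde_line f)
  then obtain s where s: "p a < s" "s < p a + h"
    "?\<phi> (p a + h) - ?\<phi> (p a) = h * (pde a f (p(b := p b + h, a := s)) - pde a f (p(a := s)))"
    using MVT2[of "p a" "p a + h" ?\<phi> "\<lambda>s. pde a f (p(b := p b + h, a := s)) - pde a f (p(a := s))"] h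
    by auto
  let ?q = "p(a := s)"
  have "((\<lambda>r. pde a f (?q(b := r))) has_real_derivative pde b (pde a f) (?q(b := r))) (at r)" for r
    by (intro pde_line smooth_pde f)
  then obtain r where r: "p b < r" "r < p b + h"
    "pde a f (?q(b := p b + h)) - pde a f (?q(b := p b)) = h * pde b (pde a f) (?q(b := r))"
    using MVT2[of "p b" "p b + h" "\<lambda>r. pde a f (?q(b := r))" "\<lambda>r. pde b (pde a f) (?q(b := r))"] h
    by auto
  have "?q(b := p b) = ?q" "p(b := p b + h, a := p a) = p(b := p b + h)" using \<open>a \<noteq> b\<close> by auto
  then show thesis
    using that[of s r] s r \<open>a \<noteq> b\<close> by (simp add: fun_upd_twist[of a b] algebra_simps)
qed

lemma pde_commute:
  assumes f: "smooth f"
  shows "pde a (pde b f) = pde b (pde a f)"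
proof (cases "a = b")
  case False
  show ?thesis
  proof
    fix p :: point
    define h where "h n = inverse (real (Suc n))" for n
    define \<Delta> where "\<Delta> n = (f (p(a := p a + h n, b := p b + h n)) - f (p(a := p a + h n))
      - f (p(b := p b + h n)) + f p) / (h n * h n)" for n
    have h: "0 < h n" for n unfolding h_def by simp
    have h0: "h \<longlonglongrightarrow> 0" unfolding h_def by (rule LIMSEQ_inverse_real_of_nat)
    \<comment> \<open>The quotient \<open>\<Delta>\<close> is symmetric in \<open>a\<close> and
      \<open>b\<close>, so one limit computation serves both orders of differentiation.\<close>
    have lim: "\<Delta> \<longlonglongrightarrow> pde d (pde c f) p" if cd: "{c, d} = {a, b}" "c \<noteq> d" for c d
    proof -
      have sq: "p(a := p a + h n, b := p b + h n) = p(c := p c + h n, d := p d + h n)" for n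
        using cd False by (auto simp: doubleton_eq_iff fun_upd_twist)
      have "\<exists>s r. p c < s \<and> s < p c + h n \<and> p d < r \<and> r < p d + h n \<and>
          \<Delta> n = pde d (pde c f) (p(c := s, d := r))" for n
      proof -
        obtain s r where "p c < s" "s < p c + h n" "p d < r" "r < p d + h n"
          "f (p(c := p c + h n, d := p d + h n)) - f (p(c := p c + h n)) - f (p(d := p d + h n)) + f p =
             h n * h n * pde d (pde c f) (p(c := s, d := r))"
          using second_difference_mvt[OF f cd(2) h] by metis
        moreover from this(5) have "\<Delta> n = pde d (pde c f) (p(c := s, d := r))"
          using cd False h[of n] unfolding \<Delta>_def sq by (auto simp: doubleton_eq_iff field_simps)
        ultimately show ?thesis by blast
      qed
      then obtain s r where sr: "\<And>n. p c < s n" "\<And>n. s n < p c + h n" "\<And>n. p d < r n"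
        "\<And>n. r n < p d + h n" "\<And>n. \<Delta> n = pde d (pde c f) (p(c := s n, d := r n))"
        by metis
      have up: "(\<lambda>n. v + h n) \<longlonglongrightarrow> v" for v :: real
        using tendsto_add[OF tendsto_const h0] by simp
      have s: "s \<longlonglongrightarrow> p c"
        by (rule tendsto_sandwich[OF _ _ tendsto_const up])
          (intro always_eventually allI less_imp_le sr)+
      have r: "r \<longlonglongrightarrow> p d"
        by (rule tendsto_sandwich[OF _ _ tendsto_const up])
          (intro always_eventually allI less_imp_le sr)+
      let ?F = "\<lambda>z. pde d (pde c f) (p(c := fst z, d := snd z))"
      have "continuous_on UNIV (\<lambda>z::real \<times> real. (p(c := fst z, d := snd z)) i)" for i
        by (cases "i = c"; cases "i = d") (auto intro!: continuous_intros)
      then have "continuous_on UNIV (\<lambda>z::real \<times> real. p(c := fst z, d := snd z))"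
        by (rule continuous_on_coordinatewise_then_product)
      moreover have "continuous_on UNIV (pde d (pde c f))"
        using smooth_C1[OF smooth_pde[OF smooth_pde[OF f]]] by (simp add: C1_def)
      ultimately have "continuous_on UNIV ?F"
        by (auto intro: continuous_on_compose2[of UNIV "pde d (pde c f)"])
      then have "isCont ?F (p c, p d)" by (simp add: continuous_on_eq_continuous_at)
      from isCont_tendsto_compose[OF this tendsto_Pair[OF s r]] show ?thesis
        by (simp add: sr(5)[abs_def])
    qed
    show "pde a (pde b f) p = pde b (pde a f) p"
      using LIMSEQ_unique[OF lim[of b a] lim[of a b]] False by blast
  qed
qed simp

section \<open>The first-order system on the line\<close>

definition nabla :: "real \<Rightarrow> (nat \<Rightarrow> real \<Rightarrow> real) \<Rightarrow> nat \<Rightarrow> real \<Rightarrow> real" where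
  "nabla l r i x = (if i = 0 then 0 else r (i - 1) x) - (if i = 1 then l * r 6 x else 0)"

text \<open>
  A family \<open>r\<close> stands for a linear form in \<open>W\<^sub>1, S, V\<^sub>1, \<dots>, V\<^sub>5\<close> with coefficients \<open>r 0, \<dots>, r 6\<close> depending on
  \<open>x\<close>; its \<open>x\<close>-derivative along the covering over \<open>u = \<xi> = 0\<close> has the coefficients \<open>r i' + nabla l r i\<close>.
  The solution of the recursion for \<open>h\<close> rests on Pascal's rule: \<open>h k i = 2 (i+k+1 choose k+1) g (i+k+2)\<close>.
\<close>

lemma no_first_order_solution:
  fixes g :: "nat \<Rightarrow> real \<Rightarrow> real" and h s :: "nat \<Rightarrow> nat \<Rightarrow> real \<Rightarrow> real" and l c2 c3 :: real
  assumes g: "\<And>i x. i \<le> 6 \<Longrightarrow> (g i has_real_derivative - nabla l g i x) (at x)"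
    and h0: "\<And>i x. i \<le> 6 \<Longrightarrow> (h 0 i has_real_derivative 2 * s 0 i x - nabla l (h 0) i x
      - (if i = 5 then - 12 * g 6 x else 0) - (if i = 1 then 2 * c2 else 0)
      - (if i = 3 then 2 * c3 else 0)) (at x)"
    and h: "\<And>k i x. i \<le> 6 \<Longrightarrow> (h (Suc k) i has_real_derivative - h k i x - nabla l (h (Suc k)) i x
      - (if i + Suc k = 5 then - 2 * real (6 choose Suc (Suc k)) * g 6 x else 0)) (at x)"
    and hN: "\<And>k i x. i \<le> 6 \<Longrightarrow> N \<le> k \<Longrightarrow> h k i x = 0"
    and s: "\<And>n i x. n < 6 \<Longrightarrow> i \<le> 6 \<Longrightarrow>
      (s n i has_real_derivative s (Suc n) i x - nabla l (s n) i x) (at x)"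
    and s6: "\<And>i x. i \<le> 6 \<Longrightarrow> s 6 i x = - l * s 0 i x + (if i = 1 then 1 else 0)"
  shows False
proof -
  have g': "(g (Suc i) has_real_derivative - g i x + (if i = 0 then l * g 6 x else 0)) (at x)"
    if "i < 6" for i x
    using g[of "Suc i" x] that by (simp add: nabla_def)
  have unique: "d = e'" if "\<And>x. f x = e x" "(f has_real_derivative d) (at x)"
    "(e has_real_derivative e') (at x)" for f e :: "real \<Rightarrow> real" and d e' x
    using DERIV_unique that by (metis ext)
  have h_eq: "h k i x = (if i + k \<le> 4 then 2 * real (i + k + 1 choose (k + 1)) * g (i + k + 2) x else 0)"
    if "i \<le> 6" for k i x
  proof -
    \<comment> \<open>Downward induction from \<open>max N 5\<close>: there the left side vanishes
      by \<open>hN\<close> and the right side because \<open>i + k > 4\<close>.\<close>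
    have "h k i x = (if i + k \<le> 4 then 2 * real (i + k + 1 choose (k + 1)) * g (i + k + 2) x else 0)"
      if "k \<le> max N 5" "i \<le> 6" for i x
      using that
    proof (induction k arbitrary: i x rule: inc_induct)
      case base
      then show ?case by (simp add: hN)
    next
      case (step k)
      let ?e = "\<lambda>x. if i + Suc k \<le> 4
        then 2 * real (i + Suc k + 1 choose (Suc k + 1)) * g (i + Suc k + 2) x else 0"
      have "(?e has_real_derivative (if i + Suc k \<le> 4
          then 2 * real (i + Suc k + 1 choose (Suc k + 1)) * - g (i + k + 2) x else 0)) (at x)"
        using DERIV_cmult[OF g'[of "i + k + 2" x], of "2 * real (i + Suc k + 1 choose (Suc k + 1))"]
        by (cases "i + Suc k \<le> 4") simp_all
      from unique[OF step.IH[OF step.prems] h[OF step.prems] this]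
      have rec: "- h k i x - nabla l (h (Suc k)) i x
          - (if i + Suc k = 5 then - 2 * real (6 choose Suc (Suc k)) * g 6 x else 0) =
        (if i + Suc k \<le> 4
          then 2 * real (i + Suc k + 1 choose (Suc k + 1)) * - g (i + k + 2) x else 0)" .
      \<comment> \<open>For \<open>i + k = 4\<close> the derivative of \<open>h (Suc k) i\<close>
        vanishes, and the source term in \<open>g 6\<close> supplies its summand of Pascal's rule
        instead.\<close>
      show ?case
      proof (cases "i + k = 4")
        case True
        then consider "i = 0" "k = 4" | "i = 1" "k = 3" | "i = 2" "k = 2" | "i = 3" "k = 1"
          | "i = 4" "k = 0"
          by linarith
        then show ?thesis
          using rec step.IH[of 6 x] step.IH[of "i - 1" x]
          by cases (simp_all add: nabla_def numeral_eq_Suc)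
      next
        case False
        then show ?thesis
          using rec step.IH[of 6 x] step.IH[of "i - 1" x] step.prems
          by (cases i) (auto simp: nabla_def algebra_simps binomial_Suc_Suc split: if_splits)
      qed
    qed
    then show ?thesis using hN that by (cases "k \<le> max N 5") auto
  qed
  \<comment> \<open>For \<open>i \<le> 4\<close> the derivative of \<open>h 0 i\<close> is
    \<open>- 2 (i + 1) g (i + 1)\<close> and \<open>nabla\<close> adds \<open>2 i g (i + 1)\<close>,
    so only \<open>- 2 g (i + 1)\<close> survives. For \<open>i = 5\<close> the source
    \<open>- 12 g 6\<close> replaces the derivative.\<close>
  have s0: "s 0 i x = (if i \<le> 5 then - g (Suc i) x else 0) + (if i = 1 then c2 else 0)
      + (if i = 3 then c3 else 0)" if "i \<le> 6" for i x
  proof -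
    let ?e = "\<lambda>x. if i \<le> 4 then 2 * real (Suc i) * g (i + 2) x else 0"
    have "(?e has_real_derivative (if i \<le> 4 then 2 * real (Suc i) * - g (Suc i) x else 0)) (at x)"
      using DERIV_cmult[OF g'[of "Suc i" x], of "2 * real (Suc i)"] by (cases "i \<le> 4") simp_all
    from unique[OF _ h0[OF that] this] h_eq[of i 0] that
    have "2 * s 0 i x - nabla l (h 0) i x - (if i = 5 then - 12 * g 6 x else 0)
        - (if i = 1 then 2 * c2 else 0) - (if i = 3 then 2 * c3 else 0) =
      (if i \<le> 4 then 2 * real (Suc i) * - g (Suc i) x else 0)"
      by simp
    then show ?thesis
      using h_eq[of 6 0 x] h_eq[of "i - 1" 0 x] that
      by (cases i) (auto simp: nabla_def algebra_simps split: if_splits)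
  qed
  \<comment> \<open>In the range used, \<open>E k\<close> is the \<open>k\<close>-th x-derivative of
    \<open>W\<^sub>1\<close> at u = \<xi> = 0: it runs through
    \<open>W\<^sub>1, S, V\<^sub>1, \<dots>, V\<^sub>5\<close> and continues with
    \<open>- l S, - l V\<^sub>1, \<dots>\<close>. The condition \<open>1 \<le> i\<close> excludes a
    return to \<open>W\<^sub>1\<close>.\<close>
  define E where "E k i = (if i = k then 1 else if 1 \<le> i \<and> i + 6 = k then - l else 0)" for k i :: nat
  have nabla_E: "(if i = 0 then 0 else E k (i - 1)) - (if i = 1 then l * E k 6 else 0) = E (Suc k) i"
    if "i \<le> 6" "1 \<le> k" "k \<le> 9" for i k
    using that unfolding E_def by auto
  \<comment> \<open>Up to \<open>n = 5\<close>, \<open>\<gamma> n\<close> is the \<open>n\<close>-th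
    derivative of \<open>- g 6\<close>; the term with \<open>l\<close> enters only in the derivative
    of \<open>g 1\<close>.\<close>
  define \<gamma> where "\<gamma> n x = (-1) ^ Suc n * g (6 - n) x" for n x
  have \<gamma>: "(\<gamma> n has_real_derivative \<gamma> (Suc n) x) (at x)" if "n < 5" for n x
    using DERIV_cmult[OF g'[of "5 - n" x], of "(-1) ^ Suc n"] that
    unfolding \<gamma>_def[abs_def] by (simp add: Suc_diff_le numeral_eq_Suc)
  have g0: "g 0 x = g 0 0" for x
    by (rule DERIV_isconst_all) (use g[of 0] in \<open>simp add: nabla_def\<close>)
  \<comment> \<open>Apart from \<open>c2\<close> and \<open>c3\<close>, the first derivative of
    \<open>s 0\<close> is \<open>g 0\<close> times \<open>W\<^sub>1\<close> plus
    \<open>\<gamma> 0\<close> times \<open>l W\<^sub>1 + V\<^sub>5\<close>. The latter form has zero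
    x-derivative, so further derivatives act only on its factor \<open>\<gamma>\<close>, while the
    other terms move along the chain.\<close>
  have s_eq: "s (Suc n) i x = (if i = 0 then l * \<gamma> n x else 0) + (if i = 6 then \<gamma> n x else 0)
      + g 0 0 * (if i = n then 1 else 0) + c2 * E (n + 2) i + c3 * E (n + 4) i"
    if "n \<le> 5" "i \<le> 6" for n i x
    using that
  proof (induction n arbitrary: i x)
    case 0
    let ?e = "\<lambda>x. (if i \<le> 5 then - g (Suc i) x else 0) + (if i = 1 then c2 else 0)
      + (if i = 3 then c3 else 0)"
    have "(?e has_real_derivative (if i \<le> 5 then g i x - (if i = 0 then l * g 6 x else 0) else 0)) (at x)"
      using g'[of i x] by (cases "i \<le> 5") (auto intro!: derivative_eq_intros)
    from unique[OF s0[OF 0(2)] s[OF _ 0(2)] this]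
    show ?case
      using s0[of 6 x] s0[of "i - 1" x] g0[of x] 0(2)
      by (cases "i = 6"; cases i) (auto simp: nabla_def E_def \<gamma>_def algebra_simps split: if_splits)
  next
    case (Suc n)
    let ?e = "\<lambda>x. (if i = 0 then l * \<gamma> n x else 0) + (if i = 6 then \<gamma> n x else 0)
      + g 0 0 * (if i = n then 1 else 0) + c2 * E (n + 2) i + c3 * E (n + 4) i"
    have "(?e has_real_derivative (if i = 0 then l * \<gamma> (Suc n) x else 0)
        + (if i = 6 then \<gamma> (Suc n) x else 0)) (at x)"
      using \<gamma>[of n x] Suc.prems by (auto intro!: derivative_eq_intros)
    from unique[OF Suc.IH s this] Suc.prems
    have "s (Suc (Suc n)) i x = (if i = 0 then l * \<gamma> (Suc n) x else 0)
        + (if i = 6 then \<gamma> (Suc n) x else 0) + nabla l (s (Suc n)) i x"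
      by simp
    also have "nabla l (s (Suc n)) i x = g 0 0 * (if i = Suc n then 1 else 0)
        + c2 * E (Suc n + 2) i + c3 * E (Suc n + 4) i"
      using Suc.IH[of 6 x] Suc.IH[of "i - 1" x] Suc.prems nabla_E[of i "n + 2"] nabla_E[of i "n + 4"]
      by (cases i) (auto simp: nabla_def algebra_simps split: if_splits)
    finally show ?case by simp
  qed
  \<comment> \<open>At index 2 every term of \<open>s_eq\<close> with \<open>n = 5\<close> vanishes.
    At index 1 only \<open>c2 * E 7 1 = - l * c2\<close> remains, which cancels the
    \<open>c2\<close> in \<open>- l * s 0 1 x\<close>.\<close>
  have g3: "l * g 3 x = 0" for x
    using s_eq[of 5 2 x] s6[of 2 x] s0[of 2 x] by (simp add: E_def)
  have g2: "l * g 2 x = - 1" for x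
  proof -
    have "s 0 1 x = c2 - g 2 x" using s0[of 1 x] by (simp add: numeral_2_eq_2)
    moreover have "s 6 1 x = - l * c2" using s_eq[of 5 1 x] by (simp add: E_def)
    moreover have "s 6 1 x = - l * s 0 1 x + 1" using s6[of 1 x] by simp
    ultimately show ?thesis by (simp only: right_diff_distrib)
  qed
  have "((\<lambda>x. l * g 3 x) has_real_derivative l * - g 2 0) (at 0)"
    using DERIV_cmult[OF g'[of 2 0], of l] by simp
  moreover have "((\<lambda>x. l * g 3 x) has_real_derivative 0) (at 0)" by (simp add: g3)
  ultimately have "l * - g 2 0 = 0" by (rule DERIV_unique)
  then show False using g2[of 0] by simp
qed

section \<open>Bodies of superfunctions\<close>

abbreviation body :: "sfun \<Rightarrow> point \<Rightarrow> real" where "body f \<equiv> coeff f {}"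

lemma smooth_coeff: "smooth (coeff f A)"
  by (rule superfunctionsD(3)[OF coeff])

lemma coeff_zero [simp]: "coeff 0 A p = 0"
  by (simp add: zero_sfun.rep_eq)

lemma coeff_add [simp]: "coeff (f + g) A p = coeff f A p + coeff g A p"
  by (simp add: plus_sfun.rep_eq)

lemma coeff_uminus [simp]: "coeff (- f) A p = - coeff f A p"
  by (simp add: uminus_sfun.rep_eq)

lemma coeff_diff [simp]: "coeff (f - g) A p = coeff f A p - coeff g A p"
  by (simp only: minus_sfun_def coeff_add coeff_uminus)

lemma coeff_scaleR [simp]: "coeff (c *\<^sub>R f) A p = c * coeff f A p"
  by (simp add: scaleR_sfun.rep_eq)

lemma coeff_sum: "coeff (\<Sum>i\<in>I. f i) A p = (\<Sum>i\<in>I. coeff (f i) A p)"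
  by (induction I rule: infinite_finite_induct) simp_all

lemma coeff_one: "coeff 1 A p = (if A = {} then 1 else 0)"
  by (simp add: one_sfun.rep_eq)

lemma coeff_of_real: "coeff (of_real c) A p = (if A = {} then c else 0)"
  by (simp add: of_real_def coeff_one)

lemma coeff_numeral: "coeff (numeral n) A p = (if A = {} then numeral n else 0)"
  using coeff_of_real[of "numeral n"] by simp

lemma body_mult [simp]: "body (f * g) p = body f p * body g p"
  by (simp add: times_sfun.rep_eq raw_mult_def)

text \<open>Coefficients of single odd coordinates are tracked because they are the bodies of odd
  derivatives. No signs arise, since one of the two factors contributes the empty set.\<close>

lemma coeff_single_mult [simp]:
  "coeff (f * g) {c} p = body f p * coeff g {c} p + coeff f {c} p * body g p"
  by (simp add: times_sfun.rep_eq raw_mult_def Pow_insert)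

lemma body_power [simp]: "body (f ^ n) p = body f p ^ n"
  by (induction n) (simp_all add: coeff_one)

lemma coeff_single_power: "coeff f {c} p = 0 \<Longrightarrow> coeff (f ^ n) {c} p = 0"
  by (induction n) (simp_all add: coeff_one)

lemma coeff_coord_ev: "coeff (coord_ev a) A p = (if A = {} then p a else 0)"
  by (simp add: coord_ev.rep_eq)

lemma coeff_coord_od: "coeff (coord_od c) A p = (if A = {c} then 1 else 0)"
  by (simp add: coord_od.rep_eq)

lemma body_pd_ev [simp]: "body (pd_ev a f) p = pde a (body f) p"
  by (simp add: pd_ev.rep_eq)

lemma body_pd_od [simp]: "body (pd_od c f) p = coeff f {c} p"
  by (simp add: pd_od.rep_eq)

lemmas coeff_simps = coeff_one coeff_of_real coeff_numeral coeff_coord_ev coeff_coord_od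
  coeff_single_power

lemma pd_cf: "pd c (cf d) = (if c = d then 1 else 0)"
proof (rule sfun_eqI)
  fix A p
  show "coeff (pd c (cf d)) A p = coeff (if c = d then 1 else 0) A p"
    by (cases c; cases d)
      (auto simp: pd_ev.rep_eq pd_od.rep_eq coord_ev.rep_eq coord_od.rep_eq coeff_one pde_coord
        pde_const koszul_def if_distrib)
qed

lemma pd_support_cf: "{c. pd c (cf d) \<noteq> 0} = {d}"
  by (auto simp: pd_cf)

lemma vapp_cf: "vapp X (cf d) = X d"
  by (simp add: vapp_def pd_support_cf pd_cf)

lemma pde_eqI: "((\<lambda>s. f (p(a := s))) has_real_derivative d) (at (p a)) \<Longrightarrow> pde a f p = d"
  by (simp add: pde_def DERIV_imp_deriv)

lemma pde_uminus: "smooth f \<Longrightarrow> pde a (\<lambda>p. - f p) p = - pde a f p"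
  by (intro pde_eqI DERIV_minus smooth_has_pde)

section \<open>Reduction of the deformation equation to bodies\<close>

definition even_fibre :: "even_coord set" where
  "even_fibre = {ES, EW1, EW2, EW3, EV1, EV2, EV3, EV4, EV5}"

lemma finite_even_fibre [simp]: "finite even_fibre"
  by (simp add: even_fibre_def)

lemma fibre_coords_Ev: "Ev a \<in> fibre_coords \<longleftrightarrow> a \<in> even_fibre"
  by (auto simp: fibre_coords_def even_fibre_def)

text \<open>\<open>X\<close> need not be homogeneous, so its odd components may have nonzero bodies;
  they meet the bodies of odd derivatives of \<open>f\<close>, which vanish by assumption.\<close>

lemma vapp_vertical_body:
  assumes X: "tau_vertical X" and f: "\<And>c. coeff f {c} p = 0"
  shows "body (vapp X f) p = (\<Sum>a\<in>even_fibre. body (X (Ev a)) p * pde a (body f) p)"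
proof -
  have "body (vapp X f) p = (\<Sum>c | pd c f \<noteq> 0. body (X c) p * body (pd c f) p)"
    by (simp add: vapp_def coeff_sum)
  also have "\<dots> = (\<Sum>c\<in>Ev ` even_fibre. body (X c) p * body (pd c f) p)"
  proof (rule sum.mono_neutral_cong)
    fix c assume "c \<in> {c. pd c f \<noteq> 0} - Ev ` even_fibre"
    then have "c \<notin> fibre_coords" if "c = Ev a" for a using that fibre_coords_Ev[of a] by auto
    then show "body (X c) p * body (pd c f) p = 0"
      using X f by (cases c) (auto simp: tau_vertical_def)
  qed (auto simp: finite_pd_support)
  also have "\<dots> = (\<Sum>a\<in>even_fibre. body (X (Ev a)) p * pde a (body f) p)"
    by (subst sum.reindex) (auto intro: inj_onI)
  finally show ?thesis .
qed

text \<open>The coordinate \<open>Bx\<close> is exceptional: its Cartan differential is 0, although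
  D_x has component 1 along it.\<close>

lemma structure_element_Bx:
  "structure_element lam c (Ev Bx) = (if c = Ev Bx then 0 else - Dx_field lam c)"
proof -
  have "Dx_bar_field c = 0" if "c \<in> fibre_coords"
    using that by (auto simp: fibre_coords_def)
  moreover have "fibre_x lam c = 0" if "c \<notin> fibre_coords"
    using that by (cases "(lam, c)" rule: fibre_x.cases) (auto simp: fibre_coords_def)
  moreover have "c \<noteq> Ev Bx" if "c \<in> fibre_coords"
    using that by (auto simp: fibre_coords_def)
  ultimately show ?thesis
    by (auto simp: structure_element_def d_cartan_def dd_def pd_cf Dx_field_def Dx_bar_def vapp_cf
        simp del: pd.simps cf.simps)
qed

lemma Dx_field_Bx: "Dx_field lam (Ev Bx) = 1"
  by (simp add: Dx_field_def)

lemma contract_Bx_body: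
  "body (vform_app (structure_element lam) f (Ev Bx)) p =
     pde Bx (body f) p - (\<Sum>c | pd c f \<noteq> 0. body (Dx_field lam c) p * body (pd c f) p)"
proof -
  have "body (vform_app (structure_element lam) f (Ev Bx)) p =
      (\<Sum>c | pd c f \<noteq> 0. (if c = Ev Bx then pde Bx (body f) p else 0)
        - body (Dx_field lam c) p * body (pd c f) p)"
    by (auto simp: vform_app_def contract_def dd_def coeff_sum structure_element_Bx
        Dx_field_Bx coeff_one intro!: sum.cong)
  moreover have "pde Bx (body f) p = 0" if "pd (Ev Bx) f = 0"
    using that by (metis body_pd_ev coeff_zero pd.simps(1))
  ultimately show ?thesis
    by (auto simp: sum_subtractf finite_pd_support)
qed

text \<open>This is the dx-part of the equation tested on the coordinate \<open>w\<close>. The Lie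
  derivative of U(w) along \<open>X\<close> contributes the partial x-derivative of X_w minus
  X(w_x), and U(X_w) contributes that same partial derivative minus D_x X_w. The difference is D_x
  X_w - X(w_x), to be matched with the parameter derivative of - w_x.\<close>

lemma body_deformation_equation:
  assumes X: "tau_vertical X" and eq: "deformation_equation lam X" and w: "w \<in> even_fibre"
    and even: "\<And>c p. coeff (fibre_x lam (Ev w)) {c} p = 0"
    and der: "((\<lambda>l. body (fibre_x l (Ev w)) p) has_real_derivative d) (at lam)"
  shows "(\<Sum>c | pd c (X (Ev w)) \<noteq> 0. body (Dx_field lam c) p * body (pd c (X (Ev w))) p) =
    (\<Sum>a\<in>even_fibre. body (X (Ev a)) p * pde a (body (fibre_x lam (Ev w))) p) - d"
proof -
  let ?w = "Ev w" and ?e = "Ev Bx" and ?U = "structure_element lam"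
  have wf: "?w \<in> fibre_coords" using w by (simp add: fibre_coords_Ev)
  have U_cf: "vform_app (structure_element l) (cf ?w) = structure_element l ?w" for l
    by (rule ext) (simp add: vform_app_def contract_def dd_def pd_support_cf pd_cf
        del: pd.simps cf.simps)
  have U_e: "structure_element l ?w ?e = - fibre_x l ?w" for l
    using wf by (auto simp: structure_element_Bx Dx_field_def fibre_coords_def)
  \<comment> \<open>Among fibre coordinates U(w) has a coefficient only at \<open>w\<close>, and
    outside the fibre \<open>X\<close> vanishes; the sum in \<open>lie\<close> thus reduces to one
    term.\<close>
  have dX: "dd (X c) e * ?U ?w c = (if c = ?w then dd (X c) e else 0)" for c e
  proof (cases "c \<in> fibre_coords")
    case True
    then have "c \<noteq> Ev Bx" "c \<noteq> Ev Bt" by (auto simp: fibre_coords_def)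
    then show ?thesis using wf
      by (simp add: structure_element_def dd_def pd_cf del: pd.simps cf.simps)
  next
    case False
    then have "X c = 0" using X by (simp add: tau_vertical_def)
    then have "dd (X c) e = 0"
      by (cases e) (auto simp: dd_def intro!: sfun_eqI simp: pd_ev.rep_eq pd_od.rep_eq zero_sfun.rep_eq pde_const)
    then show ?thesis using False wf by auto
  qed
  have "?w \<noteq> Ev Bx" "?w \<noteq> Ev Bt" using wf by (auto simp: fibre_coords_def)
  then have Uw: "?U ?w ?w = 1"
    using wf by (simp add: structure_element_def dd_def pd_cf del: pd.simps cf.simps)
  have fin: "finite {c. ?U ?w c \<noteq> 0}"
  proof (rule finite_subset)
    show "{c. ?U ?w c \<noteq> 0} \<subseteq> {?w, Ev Bx, Ev Bt}"
      using wf by (auto simp: structure_element_def dd_def pd_cf simp del: pd.simps cf.simps split: if_splits)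
  qed simp
  have "{c. ?U ?w c \<noteq> 0} \<inter> {c. c = ?w} = {?w}" using Uw by auto
  then have "(\<Sum>c | ?U ?w c \<noteq> 0. dd (X c) ?e * ?U ?w c) = dd (X ?w) ?e"
    using fin Uw by (simp add: dX sum.If_cases)
  then have "body (lie X (?U ?w) ?e) p = pde Bx (body (X ?w)) p + body (vapp X (- fibre_x lam ?w)) p"
    by (simp add: lie_def U_e dd_def)
  also have "body (vapp X (- fibre_x lam ?w)) p =
      - (\<Sum>a\<in>even_fibre. body (X (Ev a)) p * pde a (body (fibre_x lam ?w)) p)"
    using vapp_vertical_body[OF X, of "- fibre_x lam ?w" p] even
    by (simp add: pde_uminus[OF smooth_coeff] sum_negf uminus_sfun.rep_eq)
  finally have lie: "body (lie X (?U ?w) ?e) p = pde Bx (body (X ?w)) p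
      - (\<Sum>a\<in>even_fibre. body (X (Ev a)) p * pde a (body (fibre_x lam ?w)) p)"
    by simp
  have "((\<lambda>l. body (vform_app (structure_element l) (cf ?w) ?e) p) has_real_derivative
      body (fn_bracket X ?U (cf ?w) ?e) p) (at lam)"
    using eq by (simp only: deformation_equation_def)
  then have "((\<lambda>l. - body (fibre_x l ?w) p) has_real_derivative
      body (fn_bracket X ?U (cf ?w) ?e) p) (at lam)"
    by (simp add: U_cf U_e del: cf.simps)
  from DERIV_unique[OF this DERIV_minus[OF der]]
  have "body (fn_bracket X ?U (cf ?w) ?e) p = - d" .
  then show ?thesis
    by (simp add: fn_bracket_def U_cf vapp_cf lie contract_Bx_body del: cf.simps)
qed

section \<open>The total \<open>x\<close>-derivative at \<open>\<xi> = 0\<close>\<close>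

text \<open>\<open>fibre_coef l c a\<close> is the coefficient of \<open>a\<close> in \<open>c\<^sub>x\<close> at \<open>\<xi> = 0\<close>, with \<open>l\<close> for \<open>\<lambda>\<close>.\<close>

fun V5_coef :: "real \<Rightarrow> even_coord \<Rightarrow> point \<Rightarrow> real" where
  "V5_coef l EV4 p = - 12 * p (EU 0)"
| "V5_coef l EV3 p = - 30 * p (EU 1)"
| "V5_coef l EV2 p = - 48 * p (EU 0)^2 - 40 * p (EU 2)"
| "V5_coef l EV1 p = - 140 * p (EU 0) * p (EU 1) - 30 * p (EU 3)"
| "V5_coef l EW3 p = - 2 * p (EU 1)"
| "V5_coef l EW2 p = - 12 * p (EU 0) * p (EU 1) - 2 * p (EU 3)"
| "V5_coef l EW1 p = - 60 * p (EU 0)^2 * p (EU 1) - 20 * p (EU 0) * p (EU 3) - 2 * p (EU 5)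
     - 40 * p (EU 2) * p (EU 1)"
| "V5_coef l ES p = - 64 * p (EU 0)^3 - 96 * p (EU 0) * p (EU 2) - 12 * p (EU 4)
     - 72 * p (EU 1)^2 - l"
| "V5_coef l a p = 0"

fun fibre_coef :: "real \<Rightarrow> even_coord \<Rightarrow> even_coord \<Rightarrow> point \<Rightarrow> real" where
  "fibre_coef l EW1 a p = (if a = ES then 1 else 0)"
| "fibre_coef l ES a p = (if a = EV1 then 1 else 0)"
| "fibre_coef l EV1 a p = (if a = EV2 then 1 else 0)"
| "fibre_coef l EV2 a p = (if a = EV3 then 1 else 0)"
| "fibre_coef l EV3 a p = (if a = EV4 then 1 else 0)"
| "fibre_coef l EV4 a p = (if a = EV5 then 1 else 0)"
| "fibre_coef l EW2 a p = (if a = ES then 2 * p (EU 0) else 0)"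
| "fibre_coef l EW3 a p = (if a = EV2 then 2 * p (EU 0) else if a = ES then 6 * p (EU 0)^2 else 0)"
| "fibre_coef l EV5 a p = V5_coef l a p"
| "fibre_coef l c a p = 0"

lemma fibre_coef_fibre [simp]:
  assumes "b \<in> even_fibre"
  shows "fibre_coef l c a (p(b := s)) = fibre_coef l c a p"
proof -
  have b: "b \<noteq> EU k" for k using assms by (auto simp: even_fibre_def)
  have "V5_coef l a (p(b := s)) = V5_coef l a p" by (cases a) (simp_all add: b[symmetric])
  then show ?thesis by (cases c) (simp_all add: b[symmetric])
qed

lemma body_fibre_x:
  assumes "c \<in> even_fibre"
  shows "body (fibre_x l (Ev c)) p = (\<Sum>a\<in>even_fibre. p a * fibre_coef l c a p)"
proof -
  have sum: "(\<Sum>a\<in>even_fibre. f a) = f ES + f EW1 + f EW2 + f EW3 + f EV1 + f EV2 + f EV3 + f EV4 + f EV5"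
    for f :: "even_coord \<Rightarrow> real"
    by (simp add: even_fibre_def)
  show ?thesis
    using assms unfolding sum even_fibre_def
    by (elim insertE) (simp_all add: fW3_x_def fV5_x_def coeff_simps)
qed

lemma coeff_single_fibre_x: "coeff (fibre_x l (Ev c)) {d} p = 0"
  by (cases c) (simp_all add: fW3_x_def fV5_x_def coeff_simps)

lemma body_Dx_field_odd: "body (Dx_field l (Od c)) p = 0"
  by (cases c) (simp_all add: Dx_field_def fQ3_x_def fO5_x_def coeff_simps)


text \<open>This is D_x on bodies of functions free of \<open>EU k\<close> for
  \<open>k \<ge> N\<close>. A fixed index set in place of the support of \<open>f\<close> allows
  differentiation term by term.\<close>

definition drift :: "nat \<Rightarrow> real \<Rightarrow> (point \<Rightarrow> real) \<Rightarrow> point \<Rightarrow> real" where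
  "drift N l f p = pde Bx f p + (\<Sum>k<N. p (EU (Suc k)) * pde (EU k) f p)
     + (\<Sum>c\<in>even_fibre. body (fibre_x l (Ev c)) p * pde c f p)"

text \<open>The odd components of D_x have zero body, so terms of \<open>f\<close> of odd degree do
  not interfere.\<close>

lemma body_Dx:
  assumes N: "\<And>k. N \<le> k \<Longrightarrow> pd (Ev (EU k)) f = 0"
  shows "(\<Sum>c | pd c f \<noteq> 0. body (Dx_field l c) p * body (pd c f) p) = drift N l (body f) p"
proof -
  let ?t = "\<lambda>a. body (Dx_field l (Ev a)) p * pde a (body f) p"
  have "(\<Sum>c | pd c f \<noteq> 0. body (Dx_field l c) p * body (pd c f) p) =
      (\<Sum>c\<in>Ev ` ({Bx} \<union> EU ` {..<N} \<union> even_fibre). body (Dx_field l c) p * body (pd c f) p)"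
  proof (rule sum.mono_neutral_cong)
    fix c assume c: "c \<in> {c. pd c f \<noteq> 0} - Ev ` ({Bx} \<union> EU ` {..<N} \<union> even_fibre)"
    show "body (Dx_field l c) p * body (pd c f) p = 0"
    proof (cases c)
      case (Ev a)
      then have a: "a \<noteq> Bx" "a \<notin> even_fibre" using c by auto
      have "a \<noteq> EU k" for k
        using c N[of k] Ev by (cases "k < N") auto
      then have "a = Bt" using a by (cases a) (auto simp: even_fibre_def)
      then show ?thesis using Ev by (simp add: Dx_field_def)
    qed (simp add: body_Dx_field_odd)
  qed (auto simp: finite_pd_support)
  also have "\<dots> = (\<Sum>a\<in>{Bx} \<union> EU ` {..<N} \<union> even_fibre. ?t a)"
    by (subst sum.reindex) (auto intro: inj_onI)
  also have "\<dots> = (\<Sum>a\<in>{Bx} \<union> EU ` {..<N}. ?t a) + (\<Sum>a\<in>even_fibre. ?t a)"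
    by (rule sum.union_disjoint) (auto simp: even_fibre_def)
  also have "(\<Sum>a\<in>{Bx} \<union> EU ` {..<N}. ?t a) = ?t Bx + (\<Sum>a\<in>EU ` {..<N}. ?t a)"
    by (subst sum.union_disjoint) auto
  also have "(\<Sum>a\<in>EU ` {..<N}. ?t a) = (\<Sum>k<N. ?t (EU k))"
    by (subst sum.reindex) (auto intro: inj_onI)
  also have "(\<Sum>a\<in>even_fibre. ?t a) = (\<Sum>c\<in>even_fibre. body (fibre_x l (Ev c)) p * pde c (body f) p)"
    by (rule sum.cong) (auto simp: Dx_field_def even_fibre_def)
  finally show ?thesis
    by (simp add: drift_def Dx_field_def coeff_one coeff_coord_ev)
qed

lemma has_pde_mult:
  assumes "smooth f" "smooth g"
  shows "((\<lambda>s. f (p(a := s)) * g (p(a := s))) has_real_derivative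
    f p * pde a g p + pde a f p * g p) (at (p a))"
  using DERIV_mult'[OF smooth_has_pde[OF assms(1), of p a] smooth_has_pde[OF assms(2), of p a]]
  by simp

text \<open>Mixed partial derivatives commute, so the commutator with D_x comes only from
  differentiating its coefficients.\<close>

lemma pde_drift:
  assumes f: "smooth f"
  shows "pde a (drift N l f) p = drift N l (pde a f) p
    + (\<Sum>k<N. (if a = EU (Suc k) then 1 else 0) * pde (EU k) f p)
    + (\<Sum>c\<in>even_fibre. pde a (body (fibre_x l (Ev c))) p * pde c f p)"
proof -
  have "((\<lambda>s. drift N l f (p(a := s))) has_real_derivative
      pde a (pde Bx f) p
      + (\<Sum>k<N. p (EU (Suc k)) * pde a (pde (EU k) f) p
          + pde a (\<lambda>p. p (EU (Suc k))) p * pde (EU k) f p)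
      + (\<Sum>c\<in>even_fibre. body (fibre_x l (Ev c)) p * pde a (pde c f) p
          + pde a (body (fibre_x l (Ev c))) p * pde c f p)) (at (p a))"
    unfolding drift_def
    by (intro DERIV_add DERIV_sum smooth_has_pde smooth_pde f
        has_pde_mult[where f = "\<lambda>p. p b" for b] has_pde_mult[where f = "body h" for h]
        smooth_coord smooth_coeff)
  from pde_eqI[OF this] show ?thesis
    by (simp add: drift_def[abs_def] sum.distrib pde_commute[OF f, of a] pde_coord)
qed

lemma smooth_drift: "smooth f \<Longrightarrow> smooth (drift N l f)"
  unfolding drift_def[abs_def]
  by (intro smooth_add smooth_sum smooth_mult smooth_coord smooth_coeff smooth_pde)

lemma pde_body_fibre_x:
  assumes c: "c \<in> even_fibre" and a: "a \<in> even_fibre"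
  shows "pde a (body (fibre_x l (Ev c))) = fibre_coef l c a"
proof
  fix p
  have "((\<lambda>s. \<Sum>b\<in>even_fibre. (p(a := s)) b * fibre_coef l c b p) has_real_derivative
      (\<Sum>b\<in>even_fibre. (if b = a then 1 else 0) * fibre_coef l c b p)) (at (p a))"
    by (intro DERIV_sum DERIV_cmult_right) auto
  then show "pde a (body (fibre_x l (Ev c))) p = fibre_coef l c a p"
    using a by (intro pde_eqI) (simp add: body_fibre_x[OF c] if_distrib[of "\<lambda>t. t * _"] sum.delta' cong: if_cong)
qed

lemma smooth_fibre_coef: "c \<in> even_fibre \<Longrightarrow> a \<in> even_fibre \<Longrightarrow> smooth (fibre_coef l c a)"
  using smooth_pde[OF smooth_coeff] pde_body_fibre_x by metis

section \<open>Taylor coefficients along the line where all coordinates but x vanish\<close>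

definition x_line :: "real \<Rightarrow> point" where "x_line x = (\<lambda>_. 0)(Bx := x)"

lemma x_line_apply: "x_line x a = (if a = Bx then x else 0)"
  by (simp add: x_line_def)

lemma x_line_derivative:
  "smooth f \<Longrightarrow> ((\<lambda>x. f (x_line x)) has_real_derivative pde Bx f (x_line x)) (at x)"
  unfolding x_line_def by (rule pde_line)

lemma body_fibre_x_line: "c \<in> even_fibre \<Longrightarrow> body (fibre_x l (Ev c)) ((x_line x)(EU k := s)) = 0"
  by (auto simp: body_fibre_x even_fibre_def x_line_apply)

lemma drift_line: "drift N l f (x_line x) = pde Bx f (x_line x)"
proof -
  have "body (fibre_x l (Ev c)) (x_line x) = 0" if "c \<in> even_fibre" for c
    using body_fibre_x_line[OF that, of l x 0 0] by (simp add: fun_upd_idem x_line_apply)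
  then show ?thesis by (simp add: drift_def x_line_apply)
qed

lemma pde_drift_fibre:
  assumes f: "smooth f" and a: "a \<in> even_fibre"
  shows "pde a (drift N l f) p = drift N l (pde a f) p
    + (\<Sum>c\<in>even_fibre. fibre_coef l c a p * pde c f p)"
proof -
  have "a \<noteq> EU (Suc k)" for k using a by (auto simp: even_fibre_def)
  then show ?thesis using a by (simp add: pde_drift[OF f] pde_body_fibre_x)
qed

text \<open>The commutator of the derivative in u_k with D_x is the derivative in u_(k-1). The w_x
  do not contribute: they are linear in the fibre variables, which vanish on the line.\<close>

lemma pde_EU_drift_line:
  assumes f: "smooth f" and N: "\<And>k. N \<le> k \<Longrightarrow> pde (EU k) f = (\<lambda>p. 0)"
  shows "pde (EU k) (drift N l f) (x_line x) = pde Bx (pde (EU k) f) (x_line x)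
    + (case k of 0 \<Rightarrow> 0 | Suc j \<Rightarrow> pde (EU j) f (x_line x))"
proof -
  have "pde (EU k) (body (fibre_x l (Ev c))) (x_line x) = 0" if "c \<in> even_fibre" for c
    by (rule pde_eqI) (simp add: body_fibre_x_line[OF that])
  moreover have "(\<Sum>j<N. (if EU k = EU (Suc j) then 1 else 0) * pde (EU j) f (x_line x)) =
      (case k of 0 \<Rightarrow> 0 | Suc j \<Rightarrow> pde (EU j) f (x_line x))"
    using N by (cases k) (auto simp: if_distrib[of "\<lambda>t. t * _"] cong: if_cong)
  ultimately show ?thesis
    by (simp add: pde_drift[OF f] drift_line)
qed

text \<open>This extracts the coefficient of u_k times \<open>a\<close> in D_x f. The last sum
  carries the part of the covering linear in u.\<close>

lemma pde_EU_drift_fibre_line: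
  assumes f: "smooth f" and N: "\<And>k. N \<le> k \<Longrightarrow> pde (EU k) f = (\<lambda>p. 0)" and a: "a \<in> even_fibre"
  shows "pde (EU k) (pde a (drift N l f)) (x_line x) = pde Bx (pde (EU k) (pde a f)) (x_line x)
    + (case k of 0 \<Rightarrow> 0 | Suc j \<Rightarrow> pde (EU j) (pde a f) (x_line x))
    + (\<Sum>c\<in>even_fibre. fibre_coef l c a (x_line x) * pde (EU k) (pde c f) (x_line x))
    + (\<Sum>c\<in>even_fibre. pde (EU k) (fibre_coef l c a) (x_line x) * pde c f (x_line x))"
proof -
  let ?p = "x_line x"
  have N': "pde (EU k) (pde a f) = (\<lambda>p. 0)" if "N \<le> k" for k
    using N[OF that] pde_commute[OF f, of "EU k" a] by (simp add: pde_const)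
  have "((\<lambda>s. drift N l (pde a f) (?p(EU k := s))
        + (\<Sum>c\<in>even_fibre. fibre_coef l c a (?p(EU k := s)) * pde c f (?p(EU k := s))))
      has_real_derivative pde (EU k) (drift N l (pde a f)) ?p
        + (\<Sum>c\<in>even_fibre. fibre_coef l c a ?p * pde (EU k) (pde c f) ?p
            + pde (EU k) (fibre_coef l c a) ?p * pde c f ?p)) (at (?p (EU k)))"
    by (intro DERIV_add DERIV_sum smooth_has_pde has_pde_mult smooth_drift smooth_pde
        smooth_fibre_coef f a)
  moreover have "pde a (drift N l f) = (\<lambda>p. drift N l (pde a f) p
      + (\<Sum>c\<in>even_fibre. fibre_coef l c a p * pde c f p))"
    by (rule ext) (rule pde_drift_fibre[OF f a])
  ultimately show ?thesis
    by (simp add: pde_eqI pde_EU_drift_line[OF smooth_pde[OF f] N'] sum.distrib)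
qed

section \<open>The covering to first order in u\<close>

definition chain_coord :: "nat \<Rightarrow> even_coord" where
  "chain_coord i = [EW1, ES, EV1, EV2, EV3, EV4, EV5] ! i"

lemma chain_coord_fibre: "i \<le> 6 \<Longrightarrow> chain_coord i \<in> even_fibre"
  using nth_mem[of i "[EW1, ES, EV1, EV2, EV3, EV4, EV5]"] by (auto simp: chain_coord_def even_fibre_def)

lemma sum_even_fibre: "(\<Sum>c\<in>even_fibre. f c) = f ES + f EW1 + f EW2 + f EW3 + f EV1 + f EV2
    + f EV3 + f EV4 + f EV5" for f :: "even_coord \<Rightarrow> real"
  by (simp add: even_fibre_def)

lemma le_6_cases:
  fixes i :: nat
  assumes "i \<le> 6"
  obtains "i = 0" | "i = 1" | "i = 2" | "i = 3" | "i = 4" | "i = 5" | "i = 6"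
  using assms by linarith

lemma fibre_coef_line_sum:
  assumes "i \<le> 6"
  shows "(\<Sum>c\<in>even_fibre. fibre_coef l c (chain_coord i) (x_line x) * r c) =
    (if i = 0 then 0 else r (chain_coord (i - 1))) - (if i = 1 then l * r EV5 else 0)"
  using assms by (rule le_6_cases) (simp_all add: sum_even_fibre chain_coord_def x_line_apply)

text \<open>At u = \<xi> = 0 neither \<open>W\<^sub>2\<close> nor \<open>W\<^sub>3\<close> occurs in
  the x-derivative of an even fibre variable.\<close>

lemma fibre_coef_line_W:
  assumes "a \<in> {EW2, EW3}"
  shows "(\<Sum>c\<in>even_fibre. fibre_coef l c a (x_line x) * r c) = 0"
  using assms by (auto simp: sum_even_fibre x_line_apply)

text \<open>The relevant u-linear terms are \<open>2 u S\<close> and \<open>2 u V\<^sub>2\<close>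
  for \<open>W\<^sub>2\<close> and \<open>W\<^sub>3\<close>, and for \<open>V\<^sub>5\<close> the
  coefficients -12, -30, -40, -30, -12, -2, which are -2 times binomial coefficients of 6.\<close>

lemma pde_EU_fibre_coef:
  assumes "i \<le> 6"
  shows "c \<in> even_fibre - {EW2, EW3, EV5} \<Longrightarrow> pde (EU k) (fibre_coef l c (chain_coord i)) (x_line x) = 0"
    and "pde (EU k) (fibre_coef l EW2 (chain_coord i)) (x_line x) = (if i = 1 \<and> k = 0 then 2 else 0)"
    and "pde (EU k) (fibre_coef l EW3 (chain_coord i)) (x_line x) = (if i = 3 \<and> k = 0 then 2 else 0)"
    and "pde (EU k) (fibre_coef l EV5 (chain_coord i)) (x_line x) =
      (if i + k = 5 then - 2 * real (6 choose Suc k) else 0)"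
proof -
  show "pde (EU k) (fibre_coef l c (chain_coord i)) (x_line x) = 0" if "c \<in> even_fibre - {EW2, EW3, EV5}"
    by (rule pde_eqI) (use that in \<open>auto simp: even_fibre_def\<close>)
  show "pde (EU k) (fibre_coef l EW2 (chain_coord i)) (x_line x) = (if i = 1 \<and> k = 0 then 2 else 0)"
    using assms
    by (rule le_6_cases; cases "k = 0"; intro pde_eqI)
      (auto simp: chain_coord_def x_line_apply intro!: derivative_eq_intros)
  show "pde (EU k) (fibre_coef l EW3 (chain_coord i)) (x_line x) = (if i = 3 \<and> k = 0 then 2 else 0)"
    using assms
    by (rule le_6_cases; cases "k = 0"; intro pde_eqI)
      (auto simp: chain_coord_def x_line_apply intro!: derivative_eq_intros)
  consider "k = 0" | "k = 1" | "k = 2" | "k = 3" | "k = 4" | "k = 5" | "5 < k" by linarith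
  then show "pde (EU k) (fibre_coef l EV5 (chain_coord i)) (x_line x) =
      (if i + k = 5 then - 2 * real (6 choose Suc k) else 0)"
    using assms
    by (cases; elim le_6_cases; intro pde_eqI)
      (auto simp: chain_coord_def x_line_apply eval_nat_numeral intro!: derivative_eq_intros)
qed

lemma pde_EU_fibre_coef_sum:
  assumes "i \<le> 6"
  shows "(\<Sum>c\<in>even_fibre. pde (EU k) (fibre_coef l c (chain_coord i)) (x_line x) * r c) =
    (if i = 1 \<and> k = 0 then 2 * r EW2 else 0) + (if i = 3 \<and> k = 0 then 2 * r EW3 else 0)
    + (if i + k = 5 then - 2 * real (6 choose Suc k) * r EV5 else 0)"
proof -
  have "(\<Sum>c\<in>even_fibre. pde (EU k) (fibre_coef l c (chain_coord i)) (x_line x) * r c) =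
      (\<Sum>c\<in>{EW2, EW3, EV5}. pde (EU k) (fibre_coef l c (chain_coord i)) (x_line x) * r c)"
    using pde_EU_fibre_coef(1)[OF assms]
    by (intro sum.mono_neutral_right) (auto simp: even_fibre_def)
  then show ?thesis
    by (simp add: pde_EU_fibre_coef(2-4)[OF assms])
qed

section \<open>Nonexistence of vertical solutions\<close>

theorem claim7:
  fixes lam :: real
  shows "\<not> (\<exists>X. tau_vertical X \<and> deformation_equation lam X)"
proof
  assume "\<exists>X. tau_vertical X \<and> deformation_equation lam X"
  then obtain X where X: "tau_vertical X" "deformation_equation lam X" by blast
  define F where "F w = body (X (Ev w))" for w
  have F: "smooth (F w)" for w unfolding F_def by (rule smooth_coeff)
  \<comment> \<open>Each component depends on finitely many u_k; \<open>N\<close> bounds these for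
    all nine even fibre directions at once.\<close>
  have "finite (\<Union>w\<in>even_fibre. (\<lambda>k. Ev (EU k)) -` {c. pd c (X (Ev w)) \<noteq> 0})"
    by (intro finite_UN_I finite_even_fibre finite_vimageI finite_pd_support) (auto intro: injI)
  then obtain N where "\<forall>k\<in>(\<Union>w\<in>even_fibre. (\<lambda>k. Ev (EU k)) -` {c. pd c (X (Ev w)) \<noteq> 0}). k < N"
    unfolding finite_nat_set_iff_bounded by blast
  then have pd_N: "pd (Ev (EU k)) (X (Ev w)) = 0" if "w \<in> even_fibre" "N \<le> k" for w k
    using that by force
  have N: "pde (EU k) (F w) = (\<lambda>p. 0)" if "w \<in> even_fibre" "N \<le> k" for w k
  proof
    fix p
    show "pde (EU k) (F w) p = 0"
      using pd_N[OF that] unfolding F_def by (metis body_pd_ev coeff_zero pd.simps(1))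
  qed
  \<comment> \<open>The extra \<open>p ES\<close> is minus the parameter derivative of the term
    \<open>- \<lambda> S\<close> in the x-derivative of \<open>V\<^sub>5\<close>.\<close>
  have eq: "drift N lam (F w) p = (\<Sum>a\<in>even_fibre. F a p * fibre_coef lam w a p)
      + (if w = EV5 then p ES else 0)" if w: "w \<in> even_fibre" for w p
  proof -
    have "((\<lambda>l. body (fibre_x l (Ev w)) p) has_real_derivative (if w = EV5 then - p ES else 0)) (at lam)"
      unfolding body_fibre_x[OF w] sum_even_fibre using w
      by (cases w) (auto simp: even_fibre_def intro!: derivative_eq_intros)
    from body_deformation_equation[OF X w coeff_single_fibre_x this]
    show ?thesis
      using body_Dx[OF pd_N[OF w], where l = lam and p = p] pde_body_fibre_x[OF w]
      by (simp add: F_def)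
  qed
  have chain_coord_6: "chain_coord 6 = EV5" by (simp add: chain_coord_def)
  have W2: "EW2 \<in> even_fibre" and V5: "EV5 \<in> even_fibre" by (simp_all add: even_fibre_def)
  have eq_W2: "drift N lam (F EW2) = (\<lambda>p. 2 * p (EU 0) * F ES p)"
    by (rule ext) (simp add: eq W2 sum_even_fibre)
  have eq_chain: "drift N lam (F (chain_coord n)) = F (chain_coord (Suc n))" if "1 \<le> n" "n < 6" for n
  proof
    fix p
    have "n \<le> 6" using that by simp
    then show "drift N lam (F (chain_coord n)) p = F (chain_coord (Suc n)) p"
      using that eq[of "chain_coord n"] chain_coord_fibre[of n]
      by (elim le_6_cases) (simp_all add: sum_even_fibre chain_coord_def)
  qed
  have eq_V5: "drift N lam (F EV5) = (\<lambda>p. (\<Sum>c\<in>even_fibre. F c p * fibre_coef lam EV5 c p) + p ES)"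
    by (rule ext) (simp add: eq V5 del: fibre_coef.simps)
  have pde_W2: "pde a (drift N lam (F EW2)) = (\<lambda>p. 2 * p (EU 0) * pde a (F ES) p)"
    if a: "a \<in> even_fibre" for a
  proof
    fix p
    have "a \<noteq> EU 0" using a by (auto simp: even_fibre_def)
    then show "pde a (drift N lam (F EW2)) p = 2 * p (EU 0) * pde a (F ES) p"
      unfolding eq_W2
      by (intro pde_eqI) (auto intro!: derivative_eq_intros smooth_has_pde F)
  qed
  have pde_EU_W2: "pde (EU k) (pde a (drift N lam (F EW2))) (x_line x) =
      (if k = 0 then 2 * pde a (F ES) (x_line x) else 0)" if a: "a \<in> even_fibre" for a k x
  proof -
    have "((\<lambda>s. ((x_line x)(EU k := s)) (EU 0) * pde a (F ES) ((x_line x)(EU k := s)))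
        has_real_derivative x_line x (EU 0) * pde (EU k) (pde a (F ES)) (x_line x)
          + pde (EU k) (\<lambda>p. p (EU 0)) (x_line x) * pde a (F ES) (x_line x)) (at (x_line x (EU k)))"
      by (rule has_pde_mult) (intro smooth_coord smooth_pde F)+
    from DERIV_cmult[OF this, of 2] show ?thesis
      unfolding pde_W2[OF a] by (intro pde_eqI; cases "k = 0") (simp_all add: x_line_apply pde_coord mult.assoc)
  qed
  have pde_V5: "pde a (drift N lam (F EV5)) (x_line x) =
      - lam * pde a (F ES) (x_line x) + (if a = ES then 1 else 0)" if a: "a \<in> even_fibre" for a x
  proof -
    let ?p = "x_line x"
    have "((\<lambda>s. (\<Sum>c\<in>even_fibre. F c (?p(a := s)) * fibre_coef lam EV5 c (?p(a := s))) + (?p(a := s)) ES)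
        has_real_derivative (\<Sum>c\<in>even_fibre. pde a (F c) ?p * fibre_coef lam EV5 c ?p)
          + pde a (\<lambda>p. p ES) ?p) (at (?p a))"
      unfolding fibre_coef_fibre[OF a]
      by (intro DERIV_add DERIV_sum DERIV_cmult_right smooth_has_pde F smooth_coord)
    then have "pde a (drift N lam (F EV5)) ?p =
        (\<Sum>c\<in>even_fibre. pde a (F c) ?p * fibre_coef lam EV5 c ?p) + pde a (\<lambda>p. p ES) ?p"
      unfolding eq_V5 by (rule pde_eqI)
    then show ?thesis by (simp add: sum_even_fibre x_line_apply pde_coord)
  qed
  have row: "((\<lambda>x. pde (chain_coord i) f (x_line x)) has_real_derivative
      pde (chain_coord i) (drift N lam f) (x_line x) - nabla lam (\<lambda>i x. pde (chain_coord i) f (x_line x)) i x) (at x)"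
    if "smooth f" "i \<le> 6" for f i x
  proof -
    have "pde (chain_coord i) (drift N lam f) (x_line x) = pde Bx (pde (chain_coord i) f) (x_line x)
        + nabla lam (\<lambda>i x. pde (chain_coord i) f (x_line x)) i x"
      by (simp add: pde_drift_fibre[OF that(1) chain_coord_fibre[OF that(2)]] drift_line
          fibre_coef_line_sum[OF that(2)] nabla_def chain_coord_6)
    then show ?thesis
      using x_line_derivative[OF smooth_pde[OF that(1)], of "chain_coord i" x] by simp
  qed
  \<comment> \<open>These two coefficients become \<open>c2\<close> and \<open>c3\<close>; they are
    constant because D_x of the \<open>W\<^sub>2\<close> component is a multiple of u.\<close>
  have const: "pde a (F EW2) (x_line x) = pde a (F EW2) (x_line 0)" if a: "a \<in> {EW2, EW3}" for a x
  proof -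
    have a': "a \<in> even_fibre" using a by (auto simp: even_fibre_def)
    then have "pde Bx (pde a (F EW2)) (x_line x) = 0" for x
      using pde_W2[OF a'] pde_drift_fibre[OF F[of EW2] a', where N = N and l = lam and p = "x_line x"]
      by (simp add: drift_line fibre_coef_line_W[OF a] x_line_apply)
    then have "\<forall>x. ((\<lambda>x. pde a (F EW2) (x_line x)) has_real_derivative 0) (at x)"
      using x_line_derivative[OF smooth_pde[OF F]] by metis
    then show ?thesis by (rule DERIV_isconst_all)
  qed
  define g where "g i x = pde (chain_coord i) (F EW2) (x_line x)" for i x
  define h where "h k i x = pde (EU k) (pde (chain_coord i) (F EW2)) (x_line x)" for k i x
  \<comment> \<open>For \<open>n < 6\<close> these are the components along
    \<open>S, V\<^sub>1, \<dots>, V\<^sub>5\<close>. The value at \<open>n = 6\<close> is the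
    right-hand side of the equation for \<open>V\<^sub>5\<close>, so that each
    \<open>s (Suc n)\<close> is the covariant derivative of \<open>s n\<close>.\<close>
  define s where "s n i x = (if n < 6 then pde (chain_coord i) (F (chain_coord (Suc n))) (x_line x)
    else - lam * pde (chain_coord i) (F ES) (x_line x) + (if i = 1 then 1 else 0))" for n i x
  have s0: "s 0 i x = pde (chain_coord i) (F ES) (x_line x)" for i x
    by (simp add: s_def chain_coord_def)
  have h_deriv: "(h k i has_real_derivative (if k = 0 then 2 * s 0 i x else 0)
      - (case k of 0 \<Rightarrow> 0 | Suc j \<Rightarrow> h j i x) - nabla lam (h k) i x
      - ((if i = 1 \<and> k = 0 then 2 * pde EW2 (F EW2) (x_line x) else 0)
        + (if i = 3 \<and> k = 0 then 2 * pde EW3 (F EW2) (x_line x) else 0)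
        + (if i + k = 5 then - 2 * real (6 choose Suc k) * g 6 x else 0))) (at x)"
    if i: "i \<le> 6" for k i x
  proof -
    have "(\<Sum>c\<in>even_fibre. fibre_coef lam c (chain_coord i) (x_line x) * pde (EU k) (pde c (F EW2)) (x_line x)) =
        nabla lam (h k) i x"
      by (simp add: fibre_coef_line_sum[OF i] nabla_def h_def chain_coord_6)
    then have "pde Bx (pde (EU k) (pde (chain_coord i) (F EW2))) (x_line x) =
      (if k = 0 then 2 * s 0 i x else 0) - (case k of 0 \<Rightarrow> 0 | Suc j \<Rightarrow> h j i x) - nabla lam (h k) i x
      - ((if i = 1 \<and> k = 0 then 2 * pde EW2 (F EW2) (x_line x) else 0)
        + (if i = 3 \<and> k = 0 then 2 * pde EW3 (F EW2) (x_line x) else 0)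
        + (if i + k = 5 then - 2 * real (6 choose Suc k) * g 6 x else 0))"
      using pde_EU_drift_fibre_line[OF F N[OF W2] chain_coord_fibre[OF i], where k = k and l = lam and x = x]
        pde_EU_W2[OF chain_coord_fibre[OF i], of k x]
        pde_EU_fibre_coef_sum[OF i, where k = k and l = lam and x = x
          and r = "\<lambda>c. pde c (F EW2) (x_line x)"]
      by (simp only: s0 g_def h_def chain_coord_6)
    then show ?thesis
      using x_line_derivative[OF smooth_pde[OF smooth_pde[OF F]], of "EU k" "chain_coord i" EW2 x]
      by (simp only: h_def[abs_def])
  qed
  show False
  proof (rule no_first_order_solution)
    show "(g i has_real_derivative - nabla lam g i x) (at x)" if "i \<le> 6" for i x
      using row[OF F that, of EW2 x] pde_W2[OF chain_coord_fibre[OF that]]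
      by (simp add: g_def[abs_def] x_line_apply)
    show "(h 0 i has_real_derivative 2 * s 0 i x - nabla lam (h 0) i x
        - (if i = 5 then - 12 * g 6 x else 0)
        - (if i = 1 then 2 * pde EW2 (F EW2) (x_line 0) else 0)
        - (if i = 3 then 2 * pde EW3 (F EW2) (x_line 0) else 0)) (at x)" if "i \<le> 6" for i x
      by (rule DERIV_cong[OF h_deriv[OF that]]) (simp add: const[of EW2 x] const[of EW3 x])
    show "(h (Suc k) i has_real_derivative - h k i x - nabla lam (h (Suc k)) i x
        - (if i + Suc k = 5 then - 2 * real (6 choose Suc (Suc k)) * g 6 x else 0)) (at x)"
      if "i \<le> 6" for k i x
      by (rule DERIV_cong[OF h_deriv[OF that]]) simp
    show "h k i x = 0" if "i \<le> 6" "N \<le> k" for k i x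
      using N[OF W2 that(2)] pde_commute[OF F, of "EU k" "chain_coord i" EW2] by (simp add: h_def pde_const)
    show "s 6 i x = - lam * s 0 i x + (if i = 1 then 1 else 0)" if "i \<le> 6" for i x
      by (simp add: s0) (simp add: s_def)
    show "(s n i has_real_derivative s (Suc n) i x - nabla lam (s n) i x) (at x)"
      if n: "n < 6" and i: "i \<le> 6" for n i x
    proof -
      have "s n = (\<lambda>i x. pde (chain_coord i) (F (chain_coord (Suc n))) (x_line x))"
        using n by (simp add: s_def fun_eq_iff)
      moreover have "pde (chain_coord i) (drift N lam (F (chain_coord (Suc n)))) (x_line x) = s (Suc n) i x"
      proof (cases "n = 5")
        case True
        have "chain_coord i = ES \<longleftrightarrow> i = 1" using i by (rule le_6_cases) (simp_all add: chain_coord_def)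
        then show ?thesis using True pde_V5[OF chain_coord_fibre[OF i], of x] by (simp add: s_def chain_coord_6)
      next
        case False
        then show ?thesis using n by (simp add: eq_chain s_def)
      qed
      ultimately show ?thesis using row[OF F i, of "chain_coord (Suc n)" x] by simp
    qed
  qed
qed

end
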